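(* Let $\mathcal{P}$ be a set of $n$ points in $\mathbb{R}^d$ and let $V\subset\mathbb{R}^d$ be an irreducible real algebraic variety of degree $D$ and dimension $d'\ge 1$. Then for every $1<r\le n$ there exists an $r$-partitioning polynomial $g$ for $\mathcal{P}$ such that $g\notin I(V)$ and $\deg g\le C\, r^{1/d'}$, where $C$ depends only on $d$ and $D$.
   Context: A real variety $V\subset\mathbb{R}^d$ is irreducible if it is irreducible over $\mathbb{R}$; its dimension is its real (semi-algebraic) dimension; its degree is the degree of its complexification $V^*$ (the Zariski closure of $V$ in $\mathbb{C}^d$). $I(V)$ is the ideal of polynomials in $\mathbb{R}[x_1,\dots,x_d]$ vanishing on $V$. For $Z(g)=\{x\in\mathbb{R}^d: g(x)=0\}$, a polynomial $g\in\mathbb{R}[x_1,\dots,x_d]$ is an $r$-partitioning polynomial for an $n$-point set $\mathcal{P}$ if no connected component of $\mathbb{R}^d\setminus Z(g)$ contains more than $n/r$ points of $\mathcal{P}$ (no restriction on points in $Z(g)$). *)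

theory Defs
  imports "HOL-Analysis.Analysis" "HOL-Library.Poly_Mapping"
begin

text \<open>Multivariate polynomials in the variables indexed by the finite type 'd,
  with coefficients in 'a: finitely supported maps from monomials (exponent
  vectors) to coefficients.  This is the standard
  representation (as in the AFP entry Polynomials); it is a comm_ring_1.\<close>

type_synonym ('d, 'a) mpoly = "('d \<Rightarrow>\<^sub>0 nat) \<Rightarrow>\<^sub>0 'a"

definition mpeval :: "('d::finite, 'a::comm_ring_1) mpoly \<Rightarrow> 'a ^ 'd \<Rightarrow> 'a" where
  "mpeval p x = (\<Sum>m\<in>Poly_Mapping.keys p. Poly_Mapping.lookup p m * (\<Prod>i\<in>UNIV. (x $ i) ^ Poly_Mapping.lookup (m :: 'd \<Rightarrow>\<^sub>0 nat) i))"

text \<open>Total degree (degree of the zero polynomial is 0).\<close>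
definition mpdeg :: "('d::finite, 'a::zero) mpoly \<Rightarrow> nat" where
  "mpdeg p = Max (insert 0 ((\<lambda>m :: 'd \<Rightarrow>\<^sub>0 nat. \<Sum>i\<in>UNIV. Poly_Mapping.lookup m i) ` Poly_Mapping.keys p))"

definition Zr :: "('d::finite, real) mpoly \<Rightarrow> (real ^ 'd) set" where
  "Zr g = {x. mpeval g x = 0}"

definition Ireal :: "(real ^ 'd::finite) set \<Rightarrow> ('d, real) mpoly set" where
  "Ireal V = {p. \<forall>x\<in>V. mpeval p x = 0}"

definition real_variety :: "(real ^ 'd::finite) set \<Rightarrow> bool" where
  "real_variety V \<longleftrightarrow> (\<exists>S. V = {x. \<forall>p\<in>S. mpeval p x = 0})"

definition real_irreducible :: "(real ^ 'd::finite) set \<Rightarrow> bool" where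
  "real_irreducible V \<longleftrightarrow> real_variety V \<and> V \<noteq> {} \<and>
     (\<forall>V1 V2. real_variety V1 \<and> real_variety V2 \<and> V = V1 \<union> V2 \<longrightarrow> V = V1 \<or> V = V2)"

definition is_ideal :: "'a::comm_ring_1 set \<Rightarrow> bool" where
  "is_ideal J \<longleftrightarrow> 0 \<in> J \<and> (\<forall>a\<in>J. \<forall>b\<in>J. a + b \<in> J) \<and> (\<forall>a\<in>J. \<forall>c. c * a \<in> J)"

definition is_prime_ideal :: "'a::comm_ring_1 set \<Rightarrow> bool" where
  "is_prime_ideal J \<longleftrightarrow> is_ideal J \<and> J \<noteq> UNIV \<and> (\<forall>a b. a * b \<in> J \<longrightarrow> a \<in> J \<or> b \<in> J)"

text \<open>Dimension of a real algebraic set V (Bochnak--Coste--Roy, Def. 2.8.1):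
  the Krull dimension of R[x]/I(V), i.e. the maximal length k of a strictly
  increasing chain of prime ideals of R[x] containing I(V).\<close>
definition real_dim :: "(real ^ 'd::finite) set \<Rightarrow> nat" where
  "real_dim V = Sup {k. \<exists>P :: nat \<Rightarrow> ('d, real) mpoly set.
      (\<forall>i\<le>k. is_prime_ideal (P i) \<and> Ireal V \<subseteq> P i) \<and> (\<forall>i<k. P i \<subset> P (Suc i))}"

definition complexification :: "(real ^ 'd::finite) set \<Rightarrow> (complex ^ 'd) set" where
  "complexification V = {z. \<forall>p :: ('d, complex) mpoly.
      (\<forall>x\<in>V. mpeval p (\<chi> i. complex_of_real (x $ i)) = 0) \<longrightarrow> mpeval p z = 0}"

definition complex_affine_subspace :: "nat \<Rightarrow> (complex ^ 'd::finite) set \<Rightarrow> bool" where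
  "complex_affine_subspace m L \<longleftrightarrow> (\<exists>a v.
      inj_on (\<lambda>t. a + (\<Sum>i<m. t i *s v i)) {t :: nat \<Rightarrow> complex. \<forall>i\<ge>m. t i = 0} \<and>
      L = (\<lambda>t. a + (\<Sum>i<m. t i *s v i)) ` {t. \<forall>i\<ge>m. t i = 0})"

text \<open>Degree of an (equidimensional) complex variety W of dimension k in C^d:
  the maximal number of points of W \<inter> L over complex affine subspaces L of
  dimension d - k meeting W in finitely many points.\<close>
definition complex_degree :: "nat \<Rightarrow> (complex ^ 'd::finite) set \<Rightarrow> nat" where
  "complex_degree k W = Sup {card (W \<inter> L) | L.
      complex_affine_subspace (CARD('d) - k) L \<and> finite (W \<inter> L)}"

definition real_var_degree :: "(real ^ 'd::finite) set \<Rightarrow> nat" where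
  "real_var_degree V = complex_degree (real_dim V) (complexification V)"

definition partitioning_poly :: "real \<Rightarrow> (real ^ 'd::finite) set \<Rightarrow> ('d, real) mpoly \<Rightarrow> bool" where
  "partitioning_poly r P g \<longleftrightarrow>
     (\<forall>x\<in>- Zr g. real (card (P \<inter> connected_component_set (- Zr g) x)) \<le> real (card P) / r)"

end

theory Submission
  imports Defs
begin

text \<open>A chain of \<open>k\<close> proper inclusions of primes above \<open>I(V)\<close>, starting at \<open>P\<close>, yields \<open>k\<close> coordinates
  that are algebraically independent modulo \<open>P\<close>; so \<open>g\<close> may be sought as a product of nonzero
  polynomials in these \<open>k\<close> coordinates, which stays outside \<open>P\<close> and hence outside \<open>I(V)\<close>. The
  constant then depends on \<open>d\<close> only.

  No ham sandwich theorem is needed, because it suffices to split sets in proportion 1:9. Given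
  \<open>m\<close> finite sets and more than \<open>m\<close> monomials, choose a random point in each set and the
  polynomial of least leading index vanishing at all of them. With all points but the one in \<open>A\<close>
  fixed, this polynomial lies in a fixed pencil, and a tournament argument shows that it splits
  \<open>A\<close> with probability at least 1/2. So some polynomial of degree \<open>O(m^(1/k))\<close> splits half of the
  sets, and repeating this on the remaining ones splits all with the same order of degree.\<close>

section \<open>Algebraicity modulo a prime ideal\<close>

lemma is_ideal_sum:
  assumes "is_ideal J" "\<And>i. i \<in> I \<Longrightarrow> f i \<in> J"
  shows "sum f I \<in> J"
  using assms(2)
  by (induction I rule: infinite_finite_induct) (use assms(1) in \<open>auto simp: is_ideal_def\<close>)

lemma is_ideal_zero: "is_ideal J \<Longrightarrow> 0 \<in> J"
  by (simp add: is_ideal_def)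

lemma is_ideal_multL: "is_ideal J \<Longrightarrow> a \<in> J \<Longrightarrow> c * a \<in> J"
  by (auto simp: is_ideal_def)

lemma is_ideal_multR: "is_ideal J \<Longrightarrow> a \<in> J \<Longrightarrow> a * c \<in> J"
  by (metis is_ideal_multL mult.commute)

lemma is_ideal_add: "is_ideal J \<Longrightarrow> a \<in> J \<Longrightarrow> b \<in> J \<Longrightarrow> a + b \<in> J"
  by (auto simp: is_ideal_def)

lemma is_ideal_uminus: "is_ideal J \<Longrightarrow> a \<in> J \<Longrightarrow> - a \<in> J"
  using is_ideal_multL[of J a "-1"] by simp

lemma is_ideal_diff: "is_ideal J \<Longrightarrow> a \<in> J \<Longrightarrow> b \<in> J \<Longrightarrow> a - b \<in> J"
  using is_ideal_add[of J a "- b"] is_ideal_uminus[of J b] by simp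

lemma is_prime_ideal_one: "is_prime_ideal J \<Longrightarrow> 1 \<notin> J"
  unfolding is_prime_ideal_def using is_ideal_multL[of J 1] by fastforce

lemma is_prime_ideal_mult: "is_prime_ideal J \<Longrightarrow> a \<notin> J \<Longrightarrow> b \<notin> J \<Longrightarrow> a * b \<notin> J"
  unfolding is_prime_ideal_def by blast

lemma is_prime_ideal_multD: "is_prime_ideal J \<Longrightarrow> a * b \<in> J \<Longrightarrow> a \<in> J \<or> b \<in> J"
  unfolding is_prime_ideal_def by blast

lemma is_prime_ideal_power_mult:
  "is_prime_ideal J \<Longrightarrow> a \<notin> J \<Longrightarrow> a ^ n * b \<in> J \<Longrightarrow> b \<in> J"
proof (induction n)
  case (Suc n)
  then show ?case
    using is_prime_ideal_mult[of J a "a ^ n * b"] by (auto simp: mult.assoc)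
qed auto

lemma is_prime_ideal_zero: "is_prime_ideal {0 :: 'a::idom}"
proof -
  have "(1 :: 'a) \<notin> {0}" by simp
  then have "{0 :: 'a} \<noteq> UNIV" by blast
  then show ?thesis by (simp add: is_prime_ideal_def is_ideal_def)
qed

text \<open>\<open>B\<close> is the ring of coefficients. Modulo \<open>P\<close> it is an integral
  domain, and linear algebra over its fraction field is carried out by clearing denominators, which
  are elements of \<open>B\<close> outside \<open>P\<close>.\<close>

locale prime_over_subring =
  fixes P B :: "'a::comm_ring_1 set"
  assumes prime: "is_prime_ideal P"
    and zero_B: "0 \<in> B" and one_B: "1 \<in> B"
    and add_B: "\<And>a b. a \<in> B \<Longrightarrow> b \<in> B \<Longrightarrow> a + b \<in> B"
    and mult_B: "\<And>a b. a \<in> B \<Longrightarrow> b \<in> B \<Longrightarrow> a * b \<in> B"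
    and uminus_B: "\<And>a. a \<in> B \<Longrightarrow> - a \<in> B"
begin

lemma ideal: "is_ideal P"
  using prime by (simp add: is_prime_ideal_def)

lemma sum_B: "(\<And>i. i \<in> I \<Longrightarrow> f i \<in> B) \<Longrightarrow> sum f I \<in> B"
  by (induction I rule: infinite_finite_induct) (auto intro: zero_B add_B)

lemma diff_B: "a \<in> B \<Longrightarrow> b \<in> B \<Longrightarrow> a - b \<in> B"
  using add_B[of a "- b"] uminus_B[of b] by simp

text \<open>Gaussian elimination without division: each step keeps a pivot outside \<open>P\<close>.\<close>

lemma dependent_mod_prime:
  assumes "finite W" "finite I" "card W < card I"
    and "\<And>i w. i \<in> I \<Longrightarrow> w \<in> W \<Longrightarrow> b i w \<in> B"
  shows "\<exists>d. (\<forall>i\<in>I. d i \<in> B) \<and> (\<exists>i\<in>I. d i \<notin> P) \<and> (\<forall>w\<in>W. (\<Sum>i\<in>I. d i * b i w) \<in> P)"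
  using assms
proof (induction W arbitrary: I b rule: finite_induct)
  case empty
  then have "I \<noteq> {}" by auto
  then show ?case
    by (intro exI[of _ "\<lambda>_. 1"]) (auto simp: one_B is_prime_ideal_one[OF prime])
next
  case (insert w W)
  have cW: "card W < card I" using insert by simp
  show ?case
  proof (cases "\<forall>i\<in>I. b i w \<in> P")
    case True
    obtain d where d: "\<forall>i\<in>I. d i \<in> B" "\<exists>i\<in>I. d i \<notin> P" "\<forall>w\<in>W. (\<Sum>i\<in>I. d i * b i w) \<in> P"
      using insert.IH[OF insert.prems(1) cW, of b] insert.prems(3) by blast
    have "(\<Sum>i\<in>I. d i * b i w) \<in> P"
      using True by (intro is_ideal_sum[OF ideal] is_ideal_multL[OF ideal]) auto
    with d show ?thesis by blast
  next
    case False
    then obtain k where k: "k \<in> I" "b k w \<notin> P" by blast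
    define J where "J = I - {k}"
    define b' where "b' i v = b k w * b i v - b i w * b k v" for i v
    have J: "finite J" "card W < card J"
      using insert k by (auto simp: J_def)
    have "b' i v \<in> B" if "i \<in> J" "v \<in> W" for i v
      using that insert.prems(3) k unfolding b'_def J_def by (intro diff_B mult_B) auto
    from insert.IH[of J b', OF J this] obtain d' where d': "\<forall>i\<in>J. d' i \<in> B" "\<exists>i\<in>J. d' i \<notin> P"
      "\<forall>v\<in>W. (\<Sum>i\<in>J. d' i * b' i v) \<in> P"
      by blast
    \<comment> \<open>The entry at the pivot cancels column \<open>w\<close>; the other entries are
      scaled by the pivot value \<open>b k w\<close>, so that no division occurs.\<close>
    define d where "d i = (if i = k then - (\<Sum>i\<in>J. d' i * b i w) else b k w * d' i)" for i
    have dJ: "d i = b k w * d' i" if "i \<in> J" for i using that by (auto simp: d_def J_def)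
    have eq: "(\<Sum>i\<in>I. d i * b i v) = (\<Sum>i\<in>J. d' i * b' i v)" for v
    proof -
      have "(\<Sum>i\<in>I. d i * b i v) = d k * b k v + (\<Sum>i\<in>J. d i * b i v)"
        unfolding J_def using insert.prems(1) k(1) by (simp add: sum.remove)
      also have "(\<Sum>i\<in>J. d i * b i v) = (\<Sum>i\<in>J. b k w * d' i * b i v)"
        by (intro sum.cong refl) (simp add: dJ)
      also have "d k * b k v = (\<Sum>i\<in>J. - (d' i * b i w * b k v))"
        by (simp add: d_def sum_distrib_right sum_negf)
      finally show ?thesis
        unfolding sum.distrib[symmetric] by (simp add: b'_def algebra_simps)
    qed
    have "d i \<in> B" if "i \<in> I" for i
    proof (cases "i = k")
      case True
      then show ?thesis unfolding d_def
        using d'(1) insert.prems(3) by (auto intro!: uminus_B sum_B mult_B simp: J_def)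
    next
      case False
      then show ?thesis using that d'(1) insert.prems(3) k
        by (auto simp: d_def J_def intro!: mult_B)
    qed
    moreover have "\<exists>i\<in>I. d i \<notin> P"
    proof -
      obtain i where i: "i \<in> J" "d' i \<notin> P" using d'(2) by blast
      then have "d i \<notin> P" using is_prime_ideal_mult[OF prime k(2)] by (simp add: dJ)
      then show ?thesis using i(1) J_def by blast
    qed
    moreover have "(\<Sum>i\<in>I. d i * b i v) \<in> P" if v: "v \<in> insert w W" for v
    proof (cases "v = w")
      case True
      have "b' i w = 0" for i by (simp add: b'_def)
      then show ?thesis using True ideal unfolding eq by (simp add: is_ideal_def)
    next
      case False
      then show ?thesis using v d'(3) by (simp add: eq)
    qed
    ultimately show ?thesis by blast
  qed
qed

text \<open>Modulo \<open>P\<close>, this is the span of the family \<open>\<phi>\<close> over the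
  fraction field of the image of \<open>B\<close>, with \<open>c\<close> as a common
  denominator.\<close>

definition frac_span :: "'b set \<Rightarrow> ('b \<Rightarrow> 'a) \<Rightarrow> 'a set" where
  "frac_span W \<phi> = {f. \<exists>c b. c \<in> B \<and> c \<notin> P \<and> (\<forall>w. b w \<in> B) \<and> c * f - (\<Sum>w\<in>W. b w * \<phi> w) \<in> P}"

lemma frac_spanI:
  "c \<in> B \<Longrightarrow> c \<notin> P \<Longrightarrow> (\<And>w. b w \<in> B) \<Longrightarrow> c * f - (\<Sum>w\<in>W. b w * \<phi> w) \<in> P \<Longrightarrow> f \<in> frac_span W \<phi>"
  unfolding frac_span_def by blast

lemma frac_span_base:
  assumes "finite W" "w \<in> W"
  shows "\<phi> w \<in> frac_span W \<phi>"
proof (rule frac_spanI)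
  show "1 * \<phi> w - (\<Sum>v\<in>W. (if v = w then 1 else 0) * \<phi> v) \<in> P"
    using assms ideal by (simp add: if_distrib[of "\<lambda>x. x * _"] is_ideal_def cong: if_cong)
qed (auto simp: one_B zero_B is_prime_ideal_one[OF prime])

lemma frac_span_ideal: "f \<in> P \<Longrightarrow> f \<in> frac_span W \<phi>"
  by (rule frac_spanI[of 1 "\<lambda>_. 0"]) (auto simp: one_B zero_B is_prime_ideal_one[OF prime])

lemma frac_span_add:
  assumes "f \<in> frac_span W \<phi>" "g \<in> frac_span W \<phi>"
  shows "f + g \<in> frac_span W \<phi>"
proof -
  obtain c b where f: "c \<in> B" "c \<notin> P" "\<And>w. b w \<in> B" "c * f - (\<Sum>w\<in>W. b w * \<phi> w) \<in> P"
    using assms(1) by (auto simp: frac_span_def)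
  obtain c' b' where g: "c' \<in> B" "c' \<notin> P" "\<And>w. b' w \<in> B" "c' * g - (\<Sum>w\<in>W. b' w * \<phi> w) \<in> P"
    using assms(2) by (auto simp: frac_span_def)
  have "c * c' * (f + g) - (\<Sum>w\<in>W. (c' * b w + c * b' w) * \<phi> w)
     = c' * (c * f - (\<Sum>w\<in>W. b w * \<phi> w)) + c * (c' * g - (\<Sum>w\<in>W. b' w * \<phi> w))"
    by (simp add: algebra_simps sum_distrib_left sum.distrib)
  also have "\<dots> \<in> P"
    by (intro is_ideal_add[OF ideal] is_ideal_multL[OF ideal] f g)
  finally show ?thesis
    by (rule frac_spanI[rotated 3]) (use f g in \<open>auto intro!: mult_B add_B dest: is_prime_ideal_multD[OF prime]\<close>)
qed

lemma frac_span_mult: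
  assumes "f \<in> frac_span W \<phi>" "a \<in> B"
  shows "a * f \<in> frac_span W \<phi>"
proof -
  obtain c b where f: "c \<in> B" "c \<notin> P" "\<And>w. b w \<in> B" "c * f - (\<Sum>w\<in>W. b w * \<phi> w) \<in> P"
    using assms(1) by (auto simp: frac_span_def)
  have "c * (a * f) - (\<Sum>w\<in>W. (a * b w) * \<phi> w) = a * (c * f - (\<Sum>w\<in>W. b w * \<phi> w))"
    by (simp add: algebra_simps sum_distrib_left)
  also have "\<dots> \<in> P" by (intro is_ideal_multL[OF ideal] f)
  finally show ?thesis
    by (rule frac_spanI[rotated 3]) (use f assms in \<open>auto intro!: mult_B\<close>)
qed

lemma frac_span_sum:
  "(\<And>i. i \<in> I \<Longrightarrow> f i \<in> frac_span W \<phi>) \<Longrightarrow> sum f I \<in> frac_span W \<phi>"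
  by (induction I rule: infinite_finite_induct)
     (auto intro: frac_span_add frac_span_ideal is_ideal_zero[OF ideal])

text \<open>The factor \<open>a\<close> is absorbed into the denominator, which stays outside
  \<open>P\<close> because \<open>P\<close> is prime.\<close>

lemma frac_span_cancel:
  assumes "a * f \<in> frac_span W \<phi>" "a \<in> B" "a \<notin> P"
  shows "f \<in> frac_span W \<phi>"
proof -
  obtain c b where f: "c \<in> B" "c \<notin> P" "\<And>w. b w \<in> B" "c * (a * f) - (\<Sum>w\<in>W. b w * \<phi> w) \<in> P"
    using assms(1) by (auto simp: frac_span_def)
  show ?thesis
    by (rule frac_spanI[of "c * a" b])
       (use f assms in \<open>auto intro!: mult_B dest: is_prime_ideal_multD[OF prime] simp: mult.assoc\<close>)
qed

text \<open>Multiplication by \<open>x\<close> is linear over the coefficients, so it suffices to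
  test it on the generators.\<close>

lemma frac_span_closed:
  assumes "f \<in> frac_span W \<phi>" "\<And>w. w \<in> W \<Longrightarrow> x * \<phi> w \<in> frac_span W \<phi>"
  shows "x * f \<in> frac_span W \<phi>"
proof -
  obtain c b where f: "c \<in> B" "c \<notin> P" "\<And>w. b w \<in> B" "c * f - (\<Sum>w\<in>W. b w * \<phi> w) \<in> P"
    using assms(1) by (auto simp: frac_span_def)
  have "c * (x * f) = x * (c * f - (\<Sum>w\<in>W. b w * \<phi> w)) + (\<Sum>w\<in>W. b w * (x * \<phi> w))"
    by (simp add: algebra_simps sum_distrib_left)
  also have "\<dots> \<in> frac_span W \<phi>"
    by (intro frac_span_add frac_span_sum frac_span_mult assms(2) frac_span_ideal is_ideal_multL[OF ideal] f)
  finally show ?thesis by (rule frac_span_cancel) (use f in auto)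
qed

text \<open>\<open>B \<inter> P' = {0}\<close> makes the constant term of an algebraic relation for an element of
  \<open>P' - P\<close> vanish, so the relation can be divided by that element until it is trivial.\<close>

lemma frac_span_powers_subset:
  assumes W: "finite W" and pow: "\<And>n. f ^ n \<in> frac_span W \<phi>"
    and P': "is_ideal P'" "P \<subseteq> P'" "f \<in> P'" "B \<inter> P' \<subseteq> {0}"
  shows "f \<in> P"
proof (rule ccontr)
  assume nf: "f \<notin> P"
  have "\<forall>n. \<exists>c b. c \<in> B \<and> c \<notin> P \<and> (\<forall>w. b w \<in> B) \<and> c * f ^ n - (\<Sum>w\<in>W. b w * \<phi> w) \<in> P"
    using pow unfolding frac_span_def by blast
  then obtain c b where cb: "\<And>n. c n \<in> B" "\<And>n. c n \<notin> P" "\<And>n w. b n w \<in> B"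
     "\<And>n. c n * f ^ n - (\<Sum>w\<in>W. b n w * \<phi> w) \<in> P"
    by metis
  let ?I = "{..card W}"
  \<comment> \<open>The coefficient vectors of the \<open>card W + 1\<close> powers
    \<open>f ^ 0, ..., f ^ card W\<close> have only \<open>card W\<close> entries, so they are
    dependent modulo \<open>P\<close>.\<close>
  obtain d where d: "\<forall>i\<in>?I. d i \<in> B" "\<exists>i\<in>?I. d i \<notin> P" "\<forall>w\<in>W. (\<Sum>i\<in>?I. d i * b i w) \<in> P"
    using dependent_mod_prime[OF W, of ?I b] cb(3) by auto
  define e where "e i = d i * c i" for i
  have eB: "e i \<in> B" if "i \<in> ?I" for i using d(1) cb(1) that by (auto simp: e_def intro!: mult_B)
  have rel: "(\<Sum>i\<in>?I. e i * f ^ i) \<in> P"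
  proof -
    have "(\<Sum>i\<in>?I. e i * f ^ i) = (\<Sum>i\<in>?I. d i * (c i * f ^ i - (\<Sum>w\<in>W. b i w * \<phi> w)))
        + (\<Sum>i\<in>?I. \<Sum>w\<in>W. d i * b i w * \<phi> w)"
      by (simp add: e_def algebra_simps sum_distrib_left sum.distrib sum_subtractf)
    also have "(\<Sum>i\<in>?I. \<Sum>w\<in>W. d i * b i w * \<phi> w) = (\<Sum>w\<in>W. (\<Sum>i\<in>?I. d i * b i w) * \<phi> w)"
      by (subst sum.swap) (simp add: sum_distrib_right)
    also have "(\<Sum>i\<in>?I. d i * (c i * f ^ i - (\<Sum>w\<in>W. b i w * \<phi> w))) + \<dots> \<in> P"
      by (intro is_ideal_add[OF ideal] is_ideal_sum[OF ideal] is_ideal_multL[OF ideal]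
            is_ideal_multR[OF ideal] cb d(3)[rule_format])
    finally show ?thesis .
  qed
  \<comment> \<open>All terms below the first coefficient outside \<open>P\<close> lie in
    \<open>P\<close>. The rest has the factor \<open>f ^ k\<close>, which can be cancelled because
    \<open>f\<close> is outside the prime \<open>P\<close>.\<close>
  define k where "k = (LEAST i. i \<in> ?I \<and> e i \<notin> P)"
  have "\<exists>i. i \<in> ?I \<and> e i \<notin> P"
    using d(2) cb(2) is_prime_ideal_mult[OF prime] by (auto simp: e_def)
  then have k: "k \<in> ?I" "e k \<notin> P" and k_min: "\<And>i. i < k \<Longrightarrow> i \<in> ?I \<Longrightarrow> e i \<in> P"
    unfolding k_def by (metis (mono_tags, lifting) LeastI_ex, metis (mono_tags, lifting) LeastI_ex, metis (mono_tags, lifting) not_less_Least)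
  let ?g = "\<Sum>i\<in>{k<..card W}. e i * f ^ (i - k - 1)"
  have "{..card W} = {..<k} \<union> {k..card W}" using k(1) by auto
  then have "(\<Sum>i\<in>?I. e i * f ^ i) = (\<Sum>i<k. e i * f ^ i) + (\<Sum>i=k..card W. e i * f ^ i)"
    by (simp only:) (rule sum.union_disjoint, auto)
  also have "(\<Sum>i=k..card W. e i * f ^ i) = e k * f ^ k + (\<Sum>i\<in>{k<..card W}. e i * f ^ i)"
    using k(1) by (simp add: sum.head)
  also have "(\<Sum>i\<in>{k<..card W}. e i * f ^ i) = f ^ k * (f * ?g)"
    unfolding sum_distrib_left
  proof (intro sum.cong refl)
    fix i assume "i \<in> {k<..card W}"
    then have "i = k + Suc (i - k - 1)" by auto
    then have "f ^ i = f ^ k * (f * f ^ (i - k - 1))" by (metis power_add power_Suc)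
    then show "e i * f ^ i = f ^ k * (f * (e i * f ^ (i - k - 1)))" by (simp add: algebra_simps)
  qed
  finally have "f ^ k * (e k + f * ?g) = (\<Sum>i\<in>?I. e i * f ^ i) - (\<Sum>i<k. e i * f ^ i)"
    by (simp add: algebra_simps)
  also have "\<dots> \<in> P"
    using k by (intro is_ideal_diff[OF ideal] rel is_ideal_sum[OF ideal] is_ideal_multR[OF ideal] k_min) auto
  finally have "e k + f * ?g \<in> P" by (rule is_prime_ideal_power_mult[OF prime nf])
  then have "(e k + f * ?g) - f * ?g \<in> P'"
    using P' by (intro is_ideal_diff[OF P'(1)] is_ideal_multR[OF P'(1)]) auto
  then have "e k = 0" using P'(4) eB[OF k(1)] by auto
  then show False using k(2) ideal by (simp add: is_ideal_def)
qed

text \<open>The generators are the monomials with exponent below \<open>e j\<close> in every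
  variable \<open>j\<close>. Multiplication by \<open>x j\<close> either stays in this box or
  reaches the exponent \<open>e j\<close>, where the relation trades the power for lower ones; its
  leading coefficient is an admissible denominator.\<close>

lemma frac_span_var_closed:
  fixes x :: "'d::finite \<Rightarrow> 'a"
  assumes rel: "\<And>j. a j (e j) \<notin> P" "\<And>j l. a j l \<in> B" "\<And>j. (\<Sum>l\<le>e j. a j l * x j ^ l) \<in> P"
  defines "W \<equiv> {\<gamma>. \<forall>j. \<gamma> j < e j}" and "\<phi> \<equiv> \<lambda>\<gamma>. \<Prod>j\<in>UNIV. x j ^ \<gamma> j"
  assumes f: "f \<in> frac_span W \<phi>"
  shows "x j * f \<in> frac_span W \<phi>"
proof (rule frac_span_closed[OF f])
  fix \<gamma> assume \<gamma>: "\<gamma> \<in> W"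
  have "W = PiE UNIV (\<lambda>j. {..<e j})" by (auto simp: W_def)
  then have finW: "finite W" by (simp add: finite_PiE)
  define \<psi> where "\<psi> = (\<Prod>i\<in>UNIV - {j}. x i ^ \<gamma> i)"
  have \<phi>_upd: "\<phi> (\<gamma>(j := l)) = x j ^ l * \<psi>" for l
    unfolding \<phi>_def \<psi>_def by (subst prod.remove[of _ j]) (auto intro!: arg_cong2[where f="(*)"] prod.cong)
  have upd_W: "\<gamma>(j := l) \<in> W" if "l < e j" for l
    using \<gamma> that by (auto simp: W_def)
  have x\<phi>: "x j * \<phi> \<gamma> = x j ^ Suc (\<gamma> j) * \<psi>"
    using \<phi>_upd[of "\<gamma> j"] by (simp add: mult.assoc)
  show "x j * \<phi> \<gamma> \<in> frac_span W \<phi>"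
  proof (cases "Suc (\<gamma> j) < e j")
    case True
    then show ?thesis
      unfolding x\<phi> \<phi>_upd[symmetric] by (intro frac_span_base finW upd_W)
  next
    case False
    then have e: "e j = Suc (\<gamma> j)" using \<gamma> unfolding W_def by (metis (mono_tags) Suc_lessI mem_Collect_eq)
    have "a j (e j) * (x j * \<phi> \<gamma>)
        = (\<Sum>l\<le>e j. a j l * x j ^ l) * \<psi> + (\<Sum>l<e j. - a j l * \<phi> (\<gamma>(j := l)))"
      unfolding x\<phi> \<phi>_upd e lessThan_Suc_atMost
      by (simp add: algebra_simps sum_negf sum_distrib_left)
    also have "\<dots> \<in> frac_span W \<phi>"
      by (intro frac_span_add frac_span_sum frac_span_mult frac_span_base finW upd_W frac_span_ideal
            is_ideal_multR[OF ideal] rel uminus_B) auto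
    finally show ?thesis by (rule frac_span_cancel) (use rel in auto)
  qed
qed

end

section \<open>Splitting finite sets by linear combinations\<close>

text \<open>This is \<open>dependent_mod_prime\<close> for the zero ideal of the reals. Solutions
  are extended by zero, so that coefficient vectors are functions on all naturals.\<close>

lemma homogeneous_system_solution:
  fixes M :: "'i \<Rightarrow> nat \<Rightarrow> real"
  assumes "finite J" "card J < N"
  shows "\<exists>a. (\<forall>j\<ge>N. a j = 0) \<and> a \<noteq> (\<lambda>_. 0) \<and> (\<forall>i\<in>J. (\<Sum>j<N. a j * M i j) = 0)"
proof -
  interpret prime_over_subring "{0 :: real}" UNIV
    by standard (auto simp: is_prime_ideal_zero)
  obtain d where d: "\<exists>j\<in>{..<N}. d j \<noteq> 0" "\<forall>i\<in>J. (\<Sum>j<N. d j * M i j) = 0"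
    using dependent_mod_prime[of J "{..<N}" "\<lambda>j i. M i j"] assms by auto
  show ?thesis
    by (rule exI[of _ "\<lambda>j. if j < N then d j else 0"]) (use d in \<open>auto simp: fun_eq_iff\<close>)
qed

text \<open>For a finitely supported vector this is one more than the last index with a nonzero
  entry, and 0 exactly for the zero vector; the leading coefficient therefore sits at
  \<open>lead a - 1\<close>.\<close>

definition lead :: "(nat \<Rightarrow> real) \<Rightarrow> nat" where
  "lead a = (LEAST l. \<forall>j\<ge>l. a j = 0)"

lemma lead_le: "(\<And>j. j \<ge> l \<Longrightarrow> a j = 0) \<Longrightarrow> lead a \<le> l"
  unfolding lead_def by (rule Least_le) auto

lemma above_lead: "(\<And>j. j \<ge> N \<Longrightarrow> a j = 0) \<Longrightarrow> j \<ge> lead a \<Longrightarrow> a j = 0"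
  unfolding lead_def using LeastI[of "\<lambda>l. \<forall>j\<ge>l. a j = 0" N] by blast

lemma lead_eq_0_iff:
  assumes "\<And>j. j \<ge> N \<Longrightarrow> a j = 0"
  shows "lead a = 0 \<longleftrightarrow> a = (\<lambda>_. 0)"
proof
  assume "lead a = 0"
  then show "a = (\<lambda>_. 0)" using above_lead[of N a] assms by auto
next
  assume "a = (\<lambda>_. 0)"
  then show "lead a = 0" using lead_le[of 0 a] by simp
qed

lemma lead_coeff_nonzero:
  assumes N: "\<And>j. j \<ge> N \<Longrightarrow> a j = 0" and "a \<noteq> (\<lambda>_. 0)"
  shows "a (lead a - 1) \<noteq> 0"
proof
  assume 0: "a (lead a - 1) = 0"
  have "lead a \<noteq> 0" using assms lead_eq_0_iff[of N a] by blast
  moreover have "lead a \<le> lead a - 1"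
  proof (rule lead_le)
    fix j assume "j \<ge> lead a - 1"
    then show "a j = 0" using above_lead[of N a j] N 0 by (cases "j = lead a - 1") auto
  qed
  ultimately show False by simp
qed

text \<open>Choosing the element of least leading index in \<open>K \<inter> ker L\<close> forces it into one fixed
  two-dimensional subspace of \<open>K\<close>, whatever the functional \<open>L\<close> is and however degenerate it is on \<open>K\<close>.\<close>

lemma least_lead_in_pencil:
  assumes supp: "\<And>a j. a \<in> K \<Longrightarrow> j \<ge> N \<Longrightarrow> a j = 0"
    and lin: "\<And>a b s t. a \<in> K \<Longrightarrow> b \<in> K \<Longrightarrow> (\<lambda>j. s * a j + t * b j) \<in> K"
    and two_dim: "\<And>l. \<exists>a\<in>K. a \<noteq> (\<lambda>_. 0) \<and> a l = 0"
  obtains b1 b2 where "b1 \<in> K" "b2 \<in> K"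
    "\<And>L a. (\<And>s t a b. L (\<lambda>j. s * a j + t * b j) = s * L a + t * L b) \<Longrightarrow>
       a \<in> K \<Longrightarrow> a \<noteq> (\<lambda>_. 0) \<Longrightarrow> L a = 0 \<Longrightarrow>
       (\<And>c. c \<in> K \<Longrightarrow> c \<noteq> (\<lambda>_. 0) \<Longrightarrow> L c = 0 \<Longrightarrow> lead a \<le> lead c) \<Longrightarrow>
       \<exists>s t. (s \<noteq> 0 \<or> t \<noteq> (0::real)) \<and> a = (\<lambda>j. s * b1 j + t * b2 j)"
proof -
  define Q1 where "Q1 a \<longleftrightarrow> a \<in> K \<and> a \<noteq> (\<lambda>_. 0)" for a :: "nat \<Rightarrow> real"
  obtain b1 where b1: "Q1 b1" "\<And>a. Q1 a \<Longrightarrow> lead b1 \<le> lead a"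
    using ex_has_least_nat[of Q1 _ lead] two_dim[of 0] unfolding Q1_def by blast
  define Q2 where "Q2 a \<longleftrightarrow> a \<in> K \<and> (\<forall>t. a \<noteq> (\<lambda>j. t * b1 j))" for a
  \<comment> \<open>A nonzero vector that vanishes at the leading index of \<open>b1\<close> is no
    multiple of \<open>b1\<close>, so candidates for \<open>b2\<close> exist.\<close>
  obtain c where c: "c \<in> K" "c \<noteq> (\<lambda>_. 0)" "c (lead b1 - 1) = 0" using two_dim by blast
  have "Q2 c"
    unfolding Q2_def
  proof (intro conjI allI notI c(1))
    fix t assume eq: "c = (\<lambda>j. t * b1 j)"
    have "b1 (lead b1 - 1) \<noteq> 0"
      using b1(1) unfolding Q1_def by (intro lead_coeff_nonzero[of N]) (auto intro: supp)
    then have "t = 0" using c(3) eq by simp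
    then show False using c(2) eq by simp
  qed
  then obtain b2 where b2: "Q2 b2" "\<And>a. Q2 a \<Longrightarrow> lead b2 \<le> lead a"
    using ex_has_least_nat[of Q2 c lead] by blast
  have K: "b1 \<in> K" "b2 \<in> K" using b1 b2 by (auto simp: Q1_def Q2_def)
  have b2_0: "b2 \<noteq> (\<lambda>_. 0)"
  proof
    assume "b2 = (\<lambda>_. 0)"
    then have "b2 = (\<lambda>j. 0 * b1 j)" by simp
    then show False using b2(1) unfolding Q2_def by blast
  qed
  have le12: "lead b1 \<le> lead b2" using b1(2)[of b2] K b2_0 by (simp add: Q1_def)
  have b2_lead: "b2 (lead b2 - 1) \<noteq> 0"
    using K b2_0 by (intro lead_coeff_nonzero[of N]) (auto intro: supp)
  have lead2: "lead b2 > 0"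
    using b2_0 lead_eq_0_iff[of N b2] supp[OF K(2)] by auto
  have "\<exists>s t. (s \<noteq> 0 \<or> t \<noteq> 0) \<and> a = (\<lambda>j. s * b1 j + t * b2 j)"
    if L: "\<And>s t a b. L (\<lambda>j. s * a j + t * b j) = s * L a + t * L b"
     and a: "a \<in> K" "a \<noteq> (\<lambda>_. 0)" "L a = 0"
     and min: "\<And>c. c \<in> K \<Longrightarrow> c \<noteq> (\<lambda>_. 0) \<Longrightarrow> L c = 0 \<Longrightarrow> lead a \<le> lead c"
    for L :: "(nat \<Rightarrow> real) \<Rightarrow> real" and a
  proof -
    \<comment> \<open>Any functional kills some nontrivial combination of \<open>b1\<close> and
      \<open>b2\<close>, and this combination bounds the leading index of the minimal
      \<open>a\<close> by that of \<open>b2\<close>.\<close>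
    have "\<exists>s t. (s \<noteq> 0 \<or> t \<noteq> 0) \<and> s * L b1 + t * L b2 = 0"
    proof (cases "L b1 = 0")
      case True
      then show ?thesis by (intro exI[of _ 1] exI[of _ 0]) auto
    next
      case False
      then show ?thesis by (intro exI[of _ "- L b2"] exI[of _ "L b1"]) auto
    qed
    then obtain s t where st: "s \<noteq> 0 \<or> t \<noteq> 0" "s * L b1 + t * L b2 = 0" by blast
    define d where "d = (\<lambda>j. s * b1 j + t * b2 j)"
    have "d \<noteq> (\<lambda>_. 0)"
    proof
      assume d0: "d = (\<lambda>_. 0)"
      show False
      proof (cases "t = 0")
        case True
        then have "b1 = (\<lambda>_. 0)" using d0 st(1) by (auto simp: d_def fun_eq_iff)
        then show False using b1(1) by (simp add: Q1_def)
      next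
        case False
        have "b2 = (\<lambda>j. (- s / t) * b1 j)"
        proof
          fix j
          have "s * b1 j + t * b2 j = 0" using d0 by (simp add: d_def fun_eq_iff)
          then show "b2 j = (- s / t) * b1 j" using False by (simp add: field_simps)
        qed
        then show False using b2(1) unfolding Q2_def by blast
      qed
    qed
    moreover have "d \<in> K" "L d = 0" using K st L by (auto simp: d_def intro: lin)
    ultimately have "lead a \<le> lead d" using min by blast
    also have "lead d \<le> lead b2"
    proof (rule lead_le)
      fix j assume "j \<ge> lead b2"
      then show "d j = 0"
        using le12 above_lead[of N b1 j] above_lead[of N b2 j] supp[OF K(1)] supp[OF K(2)]
        by (simp add: d_def)
    qed
    finally have a_le: "lead a \<le> lead b2" .
    define k where "k = lead b2 - 1"
    define r where "r = a k / b2 k"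
    \<comment> \<open>Subtracting the right multiple of \<open>b2\<close> lowers the leading index
      below \<open>lead b2\<close>, so by the minimality of \<open>b2\<close> the difference is a
      multiple of \<open>b1\<close>.\<close>
    define e where "e = (\<lambda>j. 1 * a j + (- r) * b2 j)"
    have "lead e \<le> k"
    proof (rule lead_le)
      fix j assume j: "j \<ge> k"
      show "e j = 0"
      proof (cases "j = k")
        case True
        then show ?thesis using b2_lead by (simp add: e_def r_def k_def)
      next
        case False
        then have "j \<ge> lead b2" using j lead2 by (auto simp: k_def)
        then show ?thesis
          using a_le above_lead[of N a j] above_lead[of N b2 j] supp[OF a(1)] supp[OF K(2)]
          by (simp add: e_def)
      qed
    qed
    then have "\<not> Q2 e" using b2(2)[of e] lead2 by (auto simp: k_def)
    moreover have "e \<in> K" unfolding e_def by (intro lin a K)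
    ultimately obtain q where "e = (\<lambda>j. q * b1 j)" unfolding Q2_def by blast
    then have eq: "a = (\<lambda>j. q * b1 j + r * b2 j)"
      by (simp add: e_def fun_eq_iff algebra_simps)
    then have "q \<noteq> 0 \<or> r \<noteq> 0" using a(2) by auto
    then show ?thesis using eq by blast
  qed
  then show thesis using that[of b1 b2] K by blast
qed

section \<open>Balanced splitting by the members of a pencil\<close>

definition splits :: "('b \<Rightarrow> real) \<Rightarrow> 'b set \<Rightarrow> bool" where
  "splits f A \<longleftrightarrow> 10 * card {y\<in>A. f y > 0} \<le> 9 * card A \<and> 10 * card {y\<in>A. f y < 0} \<le> 9 * card A"

text \<open>Let \<open>B\<close> be the set counted on the left. By asymmetry at most half of the
  pairs in \<open>B \<times> B\<close> are related, while each \<open>p\<close> in \<open>B\<close>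
  is unrelated to fewer than a tenth of \<open>A\<close>. Double counting gives
  \<open>10 * |B|^2 \<le> 5 * |B|^2 + |B| * |A|\<close>.\<close>

lemma asymmetric_dominating_card:
  fixes R :: "'b \<Rightarrow> 'b \<Rightarrow> bool"
  assumes A: "finite A" and asym: "\<And>x y. R x y \<Longrightarrow> \<not> R y x"
  shows "5 * card {p\<in>A. 10 * card {y\<in>A. R p y} > 9 * card A} \<le> card A"
proof -
  define B where "B = {p\<in>A. 10 * card {y\<in>A. R p y} > 9 * card A}"
  have B: "finite B" "B \<subseteq> A" using A by (auto simp: B_def)
  define E where "E = (SIGMA p:B. {y\<in>B. R p y})"
  have E: "finite E" "E \<subseteq> B \<times> B" using B by (auto simp: E_def)
  have "card E + card E = card E + card (prod.swap ` E)" by (simp add: card_image)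
  also have "\<dots> = card (E \<union> prod.swap ` E)"
    using E asym by (intro card_Un_disjoint[symmetric]) (auto simp: E_def)
  also have "\<dots> \<le> card (B \<times> B)" using E B by (intro card_mono) auto
  finally have E_le: "2 * card E \<le> card B * card B" by (simp add: card_cartesian_product)
  have deg: "10 * card B \<le> 10 * card {y\<in>B. R p y} + card A" if p: "p \<in> B" for p
  proof -
    have "card A = card {y\<in>A. R p y} + card {y\<in>A. \<not> R p y}"
      using A by (subst card_Un_disjoint[symmetric]) (auto intro!: arg_cong[where f=card])
    moreover have "card B = card {y\<in>B. R p y} + card {y\<in>B. \<not> R p y}"
      using B by (subst card_Un_disjoint[symmetric]) (auto intro!: arg_cong[where f=card])
    moreover have "card {y\<in>B. \<not> R p y} \<le> card {y\<in>A. \<not> R p y}"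
      using A B by (intro card_mono) auto
    moreover have "10 * card {y\<in>A. R p y} > 9 * card A" using p by (simp add: B_def)
    ultimately show ?thesis by linarith
  qed
  have "10 * (card B * card B) = (\<Sum>p\<in>B. 10 * card B)" by simp
  also have "\<dots> \<le> (\<Sum>p\<in>B. 10 * card {y\<in>B. R p y} + card A)" by (intro sum_mono deg)
  also have "\<dots> = 10 * card E + card B * card A"
    using B by (simp add: E_def sum.distrib sum_distrib_left)
  finally have "5 * (card B * card B) \<le> card B * card A" using E_le by linarith
  then have "card B * (5 * card B) \<le> card B * card A" by (simp add: algebra_simps)
  then have "card B = 0 \<or> 5 * card B \<le> card A" by (metis mult_le_cancel1 neq0_conv)
  then show ?thesis unfolding B_def by auto
qed

text \<open>The member of a pencil vanishing at \<open>p\<close> is, up to scaling, the determinant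
  \<open>u p * v y - v p * u y\<close>, which is antisymmetric in \<open>p\<close> and \<open>y\<close>.\<close>

lemma pencil_half_split:
  fixes u v \<alpha> \<beta> :: "'b \<Rightarrow> real"
  assumes A: "finite A"
    and nz: "\<And>p. p \<in> A \<Longrightarrow> \<alpha> p \<noteq> 0 \<or> \<beta> p \<noteq> 0"
    and van: "\<And>p. p \<in> A \<Longrightarrow> \<alpha> p * u p + \<beta> p * v p = 0"
  shows "card A \<le> 2 * card {p\<in>A. splits (\<lambda>y. \<alpha> p * u y + \<beta> p * v y) A}"
proof -
  define G where "G = {p\<in>A. splits (\<lambda>y. \<alpha> p * u y + \<beta> p * v y) A}"
  define Z where "Z = {y\<in>A. u y = 0 \<and> v y = 0}"
  define R where "R p y \<longleftrightarrow> u p * v y - v p * u y > 0" for p y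
  show ?thesis
  \<comment> \<open>\<open>Z\<close> is the set of common zeros of the pencil; if it makes up a
    tenth of \<open>A\<close>, every member splits \<open>A\<close>.\<close>
  proof (cases "10 * card Z \<ge> card A")
    case True
    have card_Z: "card (A - Z) + card Z = card A"
      using A by (subst card_Un_disjoint[symmetric]) (auto simp: Z_def intro!: arg_cong[where f=card])
    have "splits (\<lambda>y. \<alpha> p * u y + \<beta> p * v y) A" for p
    proof -
      have "card {y\<in>A. \<alpha> p * u y + \<beta> p * v y > 0} \<le> card (A - Z)"
        "card {y\<in>A. \<alpha> p * u y + \<beta> p * v y < 0} \<le> card (A - Z)"
        using A by (auto intro!: card_mono simp: Z_def)
      then show ?thesis unfolding splits_def using True card_Z by linarith
    qed
    then show ?thesis by simp
  next
    case False
    define B1 where "B1 = {p\<in>A. 10 * card {y\<in>A. R p y} > 9 * card A}"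
    define B2 where "B2 = {p\<in>A. 10 * card {y\<in>A. R y p} > 9 * card A}"
    have asym: "\<not> R y x" if "R x y" for x y
      using that by (simp add: R_def mult.commute)
    have B: "5 * card B1 \<le> card A" "5 * card B2 \<le> card A"
      unfolding B1_def B2_def by (rule asymmetric_dominating_card[OF A], use asym in blast)+
    \<comment> \<open>Fewer than a tenth of the points are common zeros, and at most a fifth lie in
      each of \<open>B1\<close> and \<open>B2\<close>. Together they are less than half of
      \<open>A\<close>, which explains the proportion 1:9 in \<open>splits\<close>.\<close>
    have "A \<subseteq> G \<union> Z \<union> B1 \<union> B2"
    proof
      fix p assume p: "p \<in> A"
      show "p \<in> G \<union> Z \<union> B1 \<union> B2"
      proof (cases "p \<in> Z")
        case False
        then have uv: "u p \<noteq> 0 \<or> v p \<noteq> 0" using p by (simp add: Z_def)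
        \<comment> \<open>The solutions of one nontrivial linear equation in two unknowns are the
          multiples of \<open>(- v p, u p)\<close>; this turns the pencil member into the
          determinant.\<close>
        have "\<exists>l. l \<noteq> 0 \<and> \<alpha> p = - l * v p \<and> \<beta> p = l * u p"
        proof (cases "u p = 0")
          case True
          then have "v p \<noteq> 0" "\<beta> p = 0" using uv van[OF p] by auto
          then show ?thesis using nz[OF p] True by (intro exI[of _ "- \<alpha> p / v p"]) auto
        next
          case False
          then have "\<alpha> p = - (\<beta> p / u p) * v p" using van[OF p] by (simp add: field_simps)
          then show ?thesis using False nz[OF p] by (intro exI[of _ "\<beta> p / u p"]) auto
        qed
        then obtain l where l: "l \<noteq> 0" "\<alpha> p = - l * v p" "\<beta> p = l * u p" by blast
        have f: "\<alpha> p * u y + \<beta> p * v y = l * (u p * v y - v p * u y)" for y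
          by (simp add: l algebra_simps)
        have R': "R y p \<longleftrightarrow> u p * v y - v p * u y < 0" for y
          by (simp add: R_def mult.commute)
        have "{y\<in>A. \<alpha> p * u y + \<beta> p * v y > 0} = {y\<in>A. if l > 0 then R p y else R y p}"
          "{y\<in>A. \<alpha> p * u y + \<beta> p * v y < 0} = {y\<in>A. if l > 0 then R y p else R p y}"
          unfolding f R' R_def[of p] using l(1) by (auto simp: zero_less_mult_iff mult_less_0_iff)
        then show ?thesis using p
          unfolding Un_iff G_def B1_def B2_def splits_def by (cases "l > 0") auto
      qed auto
    qed
    moreover have "finite (G \<union> Z \<union> B1 \<union> B2)" using A by (auto simp: G_def Z_def B1_def B2_def)
    ultimately have "card A \<le> card (G \<union> Z \<union> B1 \<union> B2)" by (intro card_mono)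
    also have "\<dots> \<le> card G + card Z + card B1 + card B2"
      by (metis (no_types, opaque_lifting) add_le_mono1 card_Un_le le_trans)
    finally show ?thesis using B False unfolding G_def by linarith
  qed
qed

text \<open>The expected number of sets split by the least-lead combination vanishing at one random
  point of each set is at least half of their number.\<close>

lemma splitting_combination_exists:
  fixes \<phi> :: "nat \<Rightarrow> 'b \<Rightarrow> real" and A :: "'i \<Rightarrow> 'b set"
  assumes I: "finite I" "card I < N"
    and A: "\<And>i. i \<in> I \<Longrightarrow> finite (A i)" "\<And>i. i \<in> I \<Longrightarrow> A i \<noteq> {}"
  shows "\<exists>a. (\<exists>j<N. a j \<noteq> 0) \<and> card I \<le> 2 * card {i\<in>I. splits (\<lambda>y. \<Sum>j<N. a j * \<phi> j y) (A i)}"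
proof -
  define ev where "ev a y = (\<Sum>j<N. a j * \<phi> j y)" for a y
  define K where "K J x = {a. (\<forall>j\<ge>N. a j = 0) \<and> (\<forall>i\<in>J. ev a (x i) = 0)}" for J and x :: "'i \<Rightarrow> 'b"
  define Q where "Q x a \<longleftrightarrow> a \<in> K I x \<and> a \<noteq> (\<lambda>_. 0)" for x a
  define F where "F x = (SOME a. Q x a \<and> (\<forall>c. Q x c \<longrightarrow> lead a \<le> lead c))" for x
  have ev_lin: "ev (\<lambda>j. s * a j + t * b j) y = s * ev a y + t * ev b y" for s t a b y
    by (simp add: ev_def sum.distrib sum_distrib_left algebra_simps)
  have F: "Q x (F x) \<and> (\<forall>c. Q x c \<longrightarrow> lead (F x) \<le> lead c)" for x
  proof -
    obtain a where "Q x a"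
      using homogeneous_system_solution[OF I, of "\<lambda>i j. \<phi> j (x i)"] by (auto simp: Q_def K_def ev_def)
    then have "\<exists>a. Q x a \<and> (\<forall>c. Q x c \<longrightarrow> lead a \<le> lead c)" by (rule ex_has_least_nat[of "Q x" a lead])
    then show ?thesis unfolding F_def by (rule someI_ex)
  qed
  define good where "good x i \<longleftrightarrow> splits (ev (F x)) (A i)" for x i
  define X where "X = PiE I A"
  have finX: "finite X" using I A by (auto simp: X_def intro: finite_PiE)
  have X0: "X \<noteq> {}" using A by (auto simp: X_def PiE_eq_empty_iff)
  \<comment> \<open>All points except the one in \<open>A i\<close> are fixed by \<open>z\<close>;
    at least half of the choices \<open>p\<close> in \<open>A i\<close> are good for
    \<open>A i\<close>.\<close>
  have fibre: "card (A i) \<le> 2 * card {p\<in>A i. good (z(i := p)) i}" if i: "i \<in> I" for i z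
  proof -
    let ?K = "K (I - {i}) z"
    obtain b1 b2 where b: "b1 \<in> ?K" "b2 \<in> ?K"
      "\<And>L a. (\<And>s t a b. L (\<lambda>j. s * a j + t * b j) = s * L a + t * L b) \<Longrightarrow>
       a \<in> ?K \<Longrightarrow> a \<noteq> (\<lambda>_. 0) \<Longrightarrow> L a = 0 \<Longrightarrow>
       (\<And>c. c \<in> ?K \<Longrightarrow> c \<noteq> (\<lambda>_. 0) \<Longrightarrow> L c = 0 \<Longrightarrow> lead a \<le> lead c) \<Longrightarrow>
       \<exists>s t. (s \<noteq> 0 \<or> t \<noteq> (0::real)) \<and> a = (\<lambda>j. s * b1 j + t * b2 j)"
    proof (rule least_lead_in_pencil[of ?K N])
      show "\<exists>a\<in>?K. a \<noteq> (\<lambda>_. 0) \<and> a l = 0" for l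
      proof -
        \<comment> \<open>\<open>None\<close> encodes the condition \<open>a l = 0\<close>, and
          \<open>Some k\<close> the vanishing at the point of the other set \<open>A k\<close>.
          These are \<open>card I\<close> conditions on \<open>N\<close> coefficients.\<close>
        define M where "M o' j = (case o' of None \<Rightarrow> if j = l then 1 else 0 | Some k \<Rightarrow> \<phi> j (z k))" for o' j
        have "card (insert None (Some ` (I - {i}))) < N"
          using I i card_Suc_Diff1[of I i] by (simp add: card_image del: card_Diff_insert)
        from homogeneous_system_solution[OF _ this, of M] I obtain a where
          a: "\<forall>j\<ge>N. a j = 0" "a \<noteq> (\<lambda>_. 0)"
             "\<forall>k\<in>insert None (Some ` (I - {i})). (\<Sum>j<N. a j * M k j) = 0" by auto
        have "(\<Sum>j<N. a j * M None j) = (if l < N then a l else 0)"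
          by (simp add: M_def if_distrib[of "\<lambda>x. _ * x"] cong: if_cong)
        then have "a l = 0" using a(1,3) by (auto split: if_splits)
        moreover have "a \<in> ?K" using a(1,3) by (auto simp: K_def ev_def M_def)
        ultimately show ?thesis using a(2) by blast
      qed
    qed (auto simp: K_def ev_lin)
    \<comment> \<open>Moving \<open>p\<close> changes only the functional, evaluation at
      \<open>p\<close>, and not the space \<open>?K\<close>, so the same pencil serves all
      \<open>p\<close>.\<close>
    have "\<exists>s t. (s \<noteq> 0 \<or> t \<noteq> 0) \<and> F (z(i := p)) = (\<lambda>j. s * b1 j + t * b2 j)" for p
    proof (rule b(3)[where L = "\<lambda>a. ev a p"])
      have K: "K I (z(i := p)) = {a \<in> ?K. ev a p = 0}"
        using i by (auto simp: K_def)
      show "F (z(i := p)) \<in> ?K" "F (z(i := p)) \<noteq> (\<lambda>_. 0)" "ev (F (z(i := p))) p = 0"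
        using F[of "z(i := p)"] unfolding Q_def K by auto
      show "lead (F (z(i := p))) \<le> lead c" if "c \<in> ?K" "c \<noteq> (\<lambda>_. 0)" "ev c p = 0" for c
        using F[of "z(i := p)"] that unfolding Q_def K by auto
    qed (rule ev_lin)
    then obtain \<alpha> \<beta> where ab: "\<And>p. \<alpha> p \<noteq> 0 \<or> \<beta> p \<noteq> 0"
      "\<And>p. F (z(i := p)) = (\<lambda>j. \<alpha> p * b1 j + \<beta> p * b2 j)"
      by metis
    have evF: "ev (F (z(i := p))) = (\<lambda>y. \<alpha> p * ev b1 y + \<beta> p * ev b2 y)" for p
      by (rule ext) (simp add: ab ev_lin)
    have "ev (F (z(i := p))) p = 0" for p
      using F[of "z(i := p)"] i by (auto simp: Q_def K_def)
    then show ?thesis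
      unfolding good_def evF by (intro pencil_half_split A i ab) (simp add: ab ev_lin)
  qed
  \<comment> \<open>A choice of points is a point of \<open>A i\<close> together with a choice on
    the other indices, so summing \<open>fibre\<close> over the latter gives the bound.\<close>
  have half: "card X \<le> 2 * card {x\<in>X. good x i}" if i: "i \<in> I" for i
  proof -
    define Y where "Y = PiE (I - {i}) A"
    have X: "X = (\<lambda>(p, z). z(i := p)) ` (A i \<times> Y)"
      unfolding X_def Y_def using PiE_insert_eq[of i "I - {i}" A] i by (simp add: insert_absorb)
    have inj: "inj_on (\<lambda>(p, z). z(i := p)) (A i \<times> Y)"
      unfolding Y_def by (rule inj_combinator) simp
    have finY: "finite Y" using I A by (auto simp: Y_def intro: finite_PiE)
    have "card {x\<in>X. good x i} = (\<Sum>x\<in>X. if good x i then 1 else 0)"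
      using finX by (simp add: sum.If_cases Int_def)
    also have "\<dots> = (\<Sum>(p, z)\<in>A i \<times> Y. if good (z(i := p)) i then 1 else 0)"
      unfolding X by (subst sum.reindex[OF inj]) (simp add: case_prod_unfold)
    also have "\<dots> = (\<Sum>p\<in>A i. \<Sum>z\<in>Y. if good (z(i := p)) i then 1 else 0)"
      by (simp add: sum.cartesian_product)
    also have "\<dots> = (\<Sum>z\<in>Y. \<Sum>p\<in>A i. if good (z(i := p)) i then 1 else 0)"
      by (rule sum.swap)
    also have "\<dots> = (\<Sum>z\<in>Y. card {p\<in>A i. good (z(i := p)) i})"
      using A(1)[OF i] by (simp add: sum.If_cases Int_def)
    finally have "2 * card {x\<in>X. good x i} = (\<Sum>z\<in>Y. 2 * card {p\<in>A i. good (z(i := p)) i})"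
      by (simp add: sum_distrib_left)
    also have "\<dots> \<ge> (\<Sum>z\<in>Y. card (A i))" by (intro sum_mono fibre i)
    also have "(\<Sum>z\<in>Y. card (A i)) = card X"
      unfolding X by (simp add: card_image[OF inj] card_cartesian_product)
    finally show ?thesis .
  qed
  \<comment> \<open>Double counting of the pairs of a choice and a set that it splits.\<close>
  have "\<exists>x\<in>X. card I \<le> 2 * card {i\<in>I. good x i}"
  proof (rule ccontr)
    assume "\<not> ?thesis"
    then have "(\<Sum>x\<in>X. 2 * card {i\<in>I. good x i}) < (\<Sum>x\<in>X. card I)"
      using finX X0 by (intro sum_strict_mono) auto
    also have "\<dots> = (\<Sum>i\<in>I. card X)" by simp
    also have "\<dots> \<le> (\<Sum>i\<in>I. 2 * card {x\<in>X. good x i})" by (intro sum_mono half)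
    also have "\<dots> = 2 * (\<Sum>i\<in>I. \<Sum>x\<in>X. if good x i then 1 else 0)"
      using finX by (simp add: sum.If_cases Int_def sum_distrib_left)
    also have "\<dots> = 2 * (\<Sum>x\<in>X. \<Sum>i\<in>I. if good x i then 1 else 0)"
      by (subst sum.swap) simp
    also have "\<dots> = (\<Sum>x\<in>X. 2 * card {i\<in>I. good x i})"
      using I by (simp add: sum.If_cases Int_def sum_distrib_left)
    finally show False by simp
  qed
  then obtain x where x: "card I \<le> 2 * card {i\<in>I. good x i}" by blast
  have "F x \<noteq> (\<lambda>_. 0)" "\<forall>j\<ge>N. F x j = 0" using F[of x] by (auto simp: Q_def K_def)
  then have "\<exists>j<N. F x j \<noteq> 0" by (metis ext not_le)
  then show ?thesis using x unfolding good_def ev_def by blast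
qed

section \<open>Polynomials and independent coordinates\<close>

abbreviation monom_of :: "('d \<Rightarrow>\<^sub>0 nat) \<Rightarrow> real \<Rightarrow> ('d, real) mpoly" where
  "monom_of \<equiv> Poly_Mapping.single"

abbreviation Var :: "'d \<Rightarrow> ('d, real) mpoly" where
  "Var j \<equiv> monom_of (Poly_Mapping.single j 1) 1"

lemma poly_mapping_sum_single: "(\<Sum>m\<in>Poly_Mapping.keys p. Poly_Mapping.single m (Poly_Mapping.lookup p m)) = p"
  by (rule poly_mapping_eqI) (auto simp: lookup_sum lookup_single when_def in_keys_iff cong: if_cong)

section \<open>Evaluation and total degree of multivariate polynomials\<close>

definition mpmon :: "('d::finite \<Rightarrow>\<^sub>0 nat) \<Rightarrow> 'a::comm_ring_1 ^ 'd \<Rightarrow> 'a" where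
  "mpmon m x = (\<Prod>i\<in>UNIV. (x $ i) ^ Poly_Mapping.lookup m i)"

lemma mpmon_add: "mpmon (m + n) x = mpmon m x * mpmon n x"
  by (simp add: mpmon_def lookup_add power_add prod.distrib)

lemma mpeval_superset:
  assumes "finite M" "Poly_Mapping.keys p \<subseteq> M"
  shows "mpeval p x = (\<Sum>m\<in>M. Poly_Mapping.lookup p m * mpmon m x)"
  unfolding mpeval_def mpmon_def using assms
  by (intro sum.mono_neutral_left) (auto simp: in_keys_iff)

lemma mpeval_add: "mpeval (p + q) x = mpeval p x + mpeval q x"
proof -
  let ?M = "Poly_Mapping.keys p \<union> Poly_Mapping.keys q"
  have "mpeval p x + mpeval q x = (\<Sum>m\<in>?M. Poly_Mapping.lookup p m * mpmon m x)
      + (\<Sum>m\<in>?M. Poly_Mapping.lookup q m * mpmon m x)"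
    by (intro arg_cong2[where f = "(+)"] mpeval_superset) auto
  also have "\<dots> = (\<Sum>m\<in>?M. Poly_Mapping.lookup (p + q) m * mpmon m x)"
    by (simp add: lookup_add ring_distribs sum.distrib)
  also have "\<dots> = mpeval (p + q) x"
    by (rule mpeval_superset[symmetric]) (use keys_add[of p q] in auto)
  finally show ?thesis ..
qed

lemma mpeval_zero: "mpeval 0 x = 0"
  by (simp add: mpeval_def)

lemma mpeval_sum: "mpeval (\<Sum>i\<in>I. p i) x = (\<Sum>i\<in>I. mpeval (p i) x)"
  by (induction I rule: infinite_finite_induct) (auto simp: mpeval_add mpeval_zero)

lemma mpeval_single: "mpeval (Poly_Mapping.single m c) x = c * mpmon m x"
  by (subst mpeval_superset[of "{m}"]) auto

lemma mpeval_mult: "mpeval (p * q) x = mpeval p x * mpeval q x"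
proof -
  have "p * q = (\<Sum>m\<in>Poly_Mapping.keys p. Poly_Mapping.single m (Poly_Mapping.lookup p m)) *
       (\<Sum>n\<in>Poly_Mapping.keys q. Poly_Mapping.single n (Poly_Mapping.lookup q n))"
    by (simp only: poly_mapping_sum_single)
  also have "\<dots> = (\<Sum>m\<in>Poly_Mapping.keys p. \<Sum>n\<in>Poly_Mapping.keys q.
      Poly_Mapping.single (m + n) (Poly_Mapping.lookup p m * Poly_Mapping.lookup q n))"
    by (simp add: sum_product mult_single)
  finally have "mpeval (p * q) x = (\<Sum>m\<in>Poly_Mapping.keys p. \<Sum>n\<in>Poly_Mapping.keys q.
      (Poly_Mapping.lookup p m * mpmon m x) * (Poly_Mapping.lookup q n * mpmon n x))"
    by (simp add: mpeval_sum mpeval_single mpmon_add mult_ac)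
  also have "\<dots> = mpeval p x * mpeval q x"
    unfolding sum_product[symmetric] by (simp add: mpeval_def mpmon_def)
  finally show ?thesis .
qed

lemma continuous_on_mpeval: "continuous_on S (mpeval p :: real ^ 'd::finite \<Rightarrow> real)"
  unfolding mpeval_def by (intro continuous_intros)

lemma Zr_mult: "Zr (p * q) = Zr p \<union> Zr q"
  by (auto simp: Zr_def mpeval_mult)

lemma mpdeg_le_iff:
  "mpdeg p \<le> n \<longleftrightarrow> (\<forall>m\<in>Poly_Mapping.keys p. (\<Sum>i\<in>UNIV. Poly_Mapping.lookup m i) \<le> n)"
  unfolding mpdeg_def by (subst Max_le_iff) auto

lemma mpdeg_mult_le: "mpdeg (p * q) \<le> mpdeg p + mpdeg (q :: ('d::finite, 'a::comm_ring_1) mpoly)"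
  unfolding mpdeg_le_iff
proof
  fix m assume "m \<in> Poly_Mapping.keys (p * q)"
  then obtain a b where ab: "a \<in> Poly_Mapping.keys p" "b \<in> Poly_Mapping.keys q" "m = a + b"
    using keys_mult[of p q] by blast
  have "(\<Sum>i\<in>UNIV. Poly_Mapping.lookup a i) \<le> mpdeg p" "(\<Sum>i\<in>UNIV. Poly_Mapping.lookup b i) \<le> mpdeg q"
    using ab mpdeg_le_iff by blast+
  then show "(\<Sum>i\<in>UNIV. Poly_Mapping.lookup m i) \<le> mpdeg p + mpdeg q"
    by (simp add: ab lookup_add sum.distrib)
qed

lemma mpdeg_one: "mpdeg (1 :: ('d::finite, 'a::comm_ring_1) mpoly) = 0"
  using mpdeg_le_iff[of "1 :: ('d, 'a) mpoly" 0] by simp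

lemma Var_power: "Var j ^ l = monom_of (Poly_Mapping.single j l) 1"
  by (induction l) (auto simp: mult_single single_add[symmetric])

text \<open>Monomials are reached by induction on the total degree, pulling out one variable at a
  time; scalars and sums then give every polynomial.\<close>

lemma mpoly_closure:
  fixes p :: "('d::finite, real) mpoly"
  assumes one: "1 \<in> M" and add: "\<And>p q. p \<in> M \<Longrightarrow> q \<in> M \<Longrightarrow> p + q \<in> M"
    and const: "\<And>c p. p \<in> M \<Longrightarrow> monom_of 0 c * p \<in> M"
    and var: "\<And>j p. p \<in> M \<Longrightarrow> Var j * p \<in> M"
  shows "p \<in> M"
proof -
  have mon: "monom_of m 1 \<in> M" for m :: "'d \<Rightarrow>\<^sub>0 nat"
  proof (induction "\<Sum>i\<in>UNIV. Poly_Mapping.lookup m i" arbitrary: m rule: less_induct)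
    case less
    show ?case
    proof (cases "m = 0")
      case True
      then show ?thesis using one by simp
    next
      case False
      then obtain j where j: "Poly_Mapping.lookup m j \<noteq> 0"
        by (metis lookup_zero poly_mapping_eqI)
      define m' where "m' = m - Poly_Mapping.single j 1"
      have m: "m = Poly_Mapping.single j 1 + m'"
        by (rule poly_mapping_eqI) (use j in \<open>auto simp: m'_def lookup_add lookup_minus lookup_single when_def\<close>)
      have "(\<Sum>i\<in>UNIV. Poly_Mapping.lookup m i) = 1 + (\<Sum>i\<in>UNIV. Poly_Mapping.lookup m' i)"
        by (subst m) (simp add: lookup_add sum.distrib lookup_single when_def)
      then have "monom_of m' 1 \<in> M" by (intro less) simp
      then have "Var j * monom_of m' 1 \<in> M" by (rule var)
      then have "monom_of (Poly_Mapping.single j 1 + m') 1 \<in> M" by (simp add: mult_single)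
      then show ?thesis by (simp only: m[symmetric])
    qed
  qed
  have "0 \<in> M" using const[OF one, of 0] by simp
  moreover have "monom_of m c \<in> M" for m c
    using const[OF mon, of c m] by (simp add: mult_single)
  ultimately have "(\<Sum>m\<in>K. monom_of m (Poly_Mapping.lookup p m)) \<in> M" for K
    by (induction K rule: infinite_finite_induct) (auto intro: add)
  then show ?thesis using poly_mapping_sum_single[of p] by metis
qed

section \<open>Algebraic independence of coordinates modulo a prime ideal\<close>

definition polys_in :: "'d set \<Rightarrow> ('d::finite, real) mpoly set" where
  "polys_in S = {p. \<forall>m\<in>Poly_Mapping.keys p. Poly_Mapping.keys m \<subseteq> S}"

lemma polys_in_single: "Poly_Mapping.keys m \<subseteq> S \<Longrightarrow> monom_of m c \<in> polys_in S"
  by (simp add: polys_in_def)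

lemma polys_in_zero: "0 \<in> polys_in S" and polys_in_one: "1 \<in> polys_in S"
  by (simp_all add: polys_in_def)

lemma polys_in_add: "p \<in> polys_in S \<Longrightarrow> q \<in> polys_in S \<Longrightarrow> p + q \<in> polys_in S"
  unfolding polys_in_def using keys_add[of p q] by blast

lemma polys_in_sum: "(\<And>i. i \<in> I \<Longrightarrow> p i \<in> polys_in S) \<Longrightarrow> sum p I \<in> polys_in S"
  by (induction I rule: infinite_finite_induct) (auto intro: polys_in_add polys_in_zero)

lemma polys_in_mult: "p \<in> polys_in S \<Longrightarrow> q \<in> polys_in S \<Longrightarrow> p * q \<in> polys_in S"
proof -
  assume *: "p \<in> polys_in S" "q \<in> polys_in S"
  show ?thesis
    unfolding polys_in_def mem_Collect_eq
  proof
    fix m assume "m \<in> Poly_Mapping.keys (p * q)"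
    then obtain a b where ab: "a \<in> Poly_Mapping.keys p" "b \<in> Poly_Mapping.keys q" "m = a + b"
      using keys_mult[of p q] by blast
    have "Poly_Mapping.keys m \<subseteq> Poly_Mapping.keys a \<union> Poly_Mapping.keys b"
      unfolding ab by (rule keys_add)
    then show "Poly_Mapping.keys m \<subseteq> S" using * ab by (auto simp: polys_in_def)
  qed
qed

lemma prime_over_polys_in: "is_prime_ideal P \<Longrightarrow> prime_over_subring P (polys_in S)"
proof
  show "- a \<in> polys_in S" if "a \<in> polys_in S" for a
    using polys_in_mult[OF polys_in_single[of 0 S "-1"] that] by (simp add: single_uminus)
qed (auto intro: polys_in_add polys_in_mult polys_in_zero polys_in_one)

lemma polys_in_insert_expand:
  assumes "p \<in> polys_in (insert j S)" "j \<notin> S"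
  obtains a N where "\<And>l. a l \<in> polys_in S" "p = (\<Sum>l\<le>N. a l * Var j ^ l)"
proof -
  \<comment> \<open>The sum of all exponents of \<open>j\<close> is a crude bound for the degree in
    this variable.\<close>
  define N where "N = (\<Sum>m\<in>Poly_Mapping.keys p. Poly_Mapping.lookup m j)"
  define a where "a l = (\<Sum>m | m \<in> Poly_Mapping.keys p \<and> Poly_Mapping.lookup m j = l.
      monom_of (Poly_Mapping.update j 0 m) (Poly_Mapping.lookup p m))" for l
  have le_N: "Poly_Mapping.lookup m j \<le> N" if "m \<in> Poly_Mapping.keys p" for m
    unfolding N_def using that by (intro member_le_sum) auto
  have upd: "Poly_Mapping.update j 0 m + Poly_Mapping.single j (Poly_Mapping.lookup m j) = m" for m :: "'a \<Rightarrow>\<^sub>0 nat"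
    by (rule poly_mapping_eqI) (auto simp: lookup_add lookup_update lookup_single when_def)
  have "p = (\<Sum>m\<in>Poly_Mapping.keys p. monom_of m (Poly_Mapping.lookup p m))"
    by (rule poly_mapping_sum_single[symmetric])
  also have "\<dots> = (\<Sum>l\<in>{..N}. \<Sum>m | m \<in> Poly_Mapping.keys p \<and> Poly_Mapping.lookup m j = l.
      monom_of m (Poly_Mapping.lookup p m))"
    by (rule sum.group[symmetric]) (use le_N in auto)
  also have "\<dots> = (\<Sum>l\<le>N. a l * Var j ^ l)"
    unfolding a_def sum_distrib_right Var_power
    by (intro sum.cong refl) (auto simp: mult_single upd)
  finally have "p = (\<Sum>l\<le>N. a l * Var j ^ l)" .
  moreover have "a l \<in> polys_in S" for l
    unfolding a_def
  proof (intro polys_in_sum polys_in_single)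
    fix m assume "m \<in> {m. m \<in> Poly_Mapping.keys p \<and> Poly_Mapping.lookup m j = l}"
    then show "Poly_Mapping.keys (Poly_Mapping.update j 0 m) \<subseteq> S"
      using assms(1) by (auto simp: polys_in_def keys_update)
  qed
  ultimately show thesis using that by blast
qed

text \<open>The condition on \<open>polys_in S \<inter> P\<close> says that the coordinates in
  \<open>S\<close> are algebraically independent modulo \<open>P\<close>. Hence the top nonzero
  coefficient of \<open>p\<close>, viewed as a polynomial in \<open>Var j\<close>, is outside
  \<open>P\<close>.\<close>

lemma algebraic_relation:
  assumes p: "p \<in> polys_in (insert j S)" "p \<in> P" "p \<noteq> 0" "j \<notin> S"
    and P: "polys_in S \<inter> P \<subseteq> {0}"
  shows "\<exists>a e. a e \<notin> P \<and> (\<forall>l. a l \<in> polys_in S) \<and> (\<Sum>l\<le>e. a l * Var j ^ l) \<in> P"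
proof -
  obtain a N where a: "\<And>l. a l \<in> polys_in S" "p = (\<Sum>l\<le>N. a l * Var j ^ l)"
    using polys_in_insert_expand p by blast
  define e where "e = (GREATEST l. l \<le> N \<and> a l \<noteq> 0)"
  have "\<exists>l\<le>N. a l \<noteq> 0"
  proof (rule ccontr)
    assume "\<not> ?thesis"
    then have "p = 0" unfolding a(2) by (intro sum.neutral) auto
    then show False using p(3) by simp
  qed
  then have e: "e \<le> N" "a e \<noteq> 0" and max: "\<And>l. l \<le> N \<Longrightarrow> a l \<noteq> 0 \<Longrightarrow> l \<le> e"
    unfolding e_def
    using GreatestI_ex_nat[of "\<lambda>l. l \<le> N \<and> a l \<noteq> 0" N] Greatest_le_nat[of "\<lambda>l. l \<le> N \<and> a l \<noteq> 0" _ N]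
    by blast+
  have "p = (\<Sum>l\<le>e. a l * Var j ^ l)"
    unfolding a(2) using e max by (intro sum.mono_neutral_right) (auto, force)
  moreover have "a e \<notin> P" using P a(1) e(2) by blast
  ultimately show ?thesis using a(1) p(2) by metis
qed

text \<open>If no coordinate could be added, each would be algebraic over \<open>S\<close> modulo
  \<open>P\<close>. The whole ring would then be a finite-dimensional span over the fractions of
  \<open>polys_in S\<close>, and \<open>frac_span_powers_subset\<close> would force
  \<open>P'\<close> into \<open>P\<close>.\<close>

lemma independent_coordinates_step:
  fixes P P' :: "('d::finite, real) mpoly set"
  assumes P: "is_prime_ideal P" and P': "is_ideal P'" "P \<subset> P'" "polys_in S \<inter> P' \<subseteq> {0}"
  shows "\<exists>j. j \<notin> S \<and> polys_in (insert j S) \<inter> P \<subseteq> {0}"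
proof (rule ccontr)
  assume contr: "\<not> ?thesis"
  interpret prime_over_subring P "polys_in S" using P by (rule prime_over_polys_in)
  have "\<exists>a e. a e \<notin> P \<and> (\<forall>l. a l \<in> polys_in S) \<and> (\<Sum>l\<le>e. a l * Var j ^ l) \<in> P" for j
  proof (cases "j \<in> S")
    case True
    \<comment> \<open>A coordinate in \<open>S\<close> satisfies the trivial monic relation
      \<open>- Var j + Var j = 0\<close> of degree 1.\<close>
    show ?thesis
    proof (intro exI[of _ "\<lambda>l. if l = 0 then - Var j else 1"] exI[of _ 1] conjI allI)
      show "(if (l::nat) = 0 then - Var j else 1) \<in> polys_in S" for l
        using True by (auto intro!: uminus_B one_B polys_in_single)
    qed (use is_prime_ideal_one[OF prime] is_ideal_zero[OF ideal] in auto)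
  next
    case False
    then obtain p where "p \<in> polys_in (insert j S)" "p \<in> P" "p \<noteq> 0" using contr by blast
    then show ?thesis using False P' by (intro algebraic_relation) auto
  qed
  then have "\<forall>j. \<exists>a. \<exists>e. a e \<notin> P \<and> (\<forall>l. a l \<in> polys_in S) \<and> (\<Sum>l\<le>e. a l * Var j ^ l) \<in> P"
    by blast
  from choice[OF this] obtain a where
    "\<forall>j. \<exists>e. a j e \<notin> P \<and> (\<forall>l. a j l \<in> polys_in S) \<and> (\<Sum>l\<le>e. a j l * Var j ^ l) \<in> P" ..
  from choice[OF this] obtain e where rel: "\<And>j. a j (e j) \<notin> P" "\<And>j l. a j l \<in> polys_in S"
     "\<And>j. (\<Sum>l\<le>e j. a j l * Var j ^ l) \<in> P"
    by blast
  define W where "W = {\<gamma>. \<forall>j. \<gamma> j < e j}"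
  define \<phi> where "\<phi> = (\<lambda>\<gamma>. \<Prod>j\<in>UNIV. Var (j :: 'd) ^ \<gamma> j)"
  have "W = PiE UNIV (\<lambda>j. {..<e j})" by (auto simp: W_def)
  then have finW: "finite W" by (simp add: finite_PiE)
  \<comment> \<open>A relation of degree 0 would put its own leading coefficient into
    \<open>P\<close>. Hence the box \<open>W\<close> contains the zero exponent, and 1 is a
    generator.\<close>
  have "e j \<noteq> 0" for j
  proof
    assume "e j = 0"
    then show False using rel(1)[of j] rel(3)[of j] by simp
  qed
  then have "(\<lambda>_. 0) \<in> W" by (simp add: W_def)
  then have "\<phi> (\<lambda>_. 0) \<in> frac_span W \<phi>" by (intro frac_span_base finW)
  then have one: "1 \<in> frac_span W \<phi>" by (simp add: \<phi>_def)
  have all: "f \<in> frac_span W \<phi>" for f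
  proof (rule mpoly_closure[OF one])
    show "monom_of 0 c * p \<in> frac_span W \<phi>" if "p \<in> frac_span W \<phi>" for c p
      using that by (intro frac_span_mult polys_in_single) auto
    show "Var j * p \<in> frac_span W \<phi>" if "p \<in> frac_span W \<phi>" for j p
      using frac_span_var_closed[of a e Var, OF rel] that by (simp add: W_def \<phi>_def)
  qed (rule frac_span_add)
  obtain f where f: "f \<in> P'" "f \<notin> P" using P' by blast
  have "f \<in> P" by (rule frac_span_powers_subset[OF finW all P'(1) _ f(1) P'(3)]) (use P' in auto)
  then show False using f by simp
qed

text \<open>Induction from the top of the chain downwards: a prime contains no nonzero constant, so
  the empty set is independent modulo the last prime, and every strict inclusion below it yields one
  more coordinate.\<close>

lemma prime_chain_independent_coordinates:
  fixes P :: "nat \<Rightarrow> ('d::finite, real) mpoly set"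
  assumes "\<And>i. i \<le> k \<Longrightarrow> is_prime_ideal (P i)" "\<And>i. i < k \<Longrightarrow> P i \<subset> P (Suc i)"
  shows "\<exists>S. card S = k \<and> polys_in S \<inter> P 0 \<subseteq> {0}"
  using assms
proof (induction k arbitrary: P)
  case 0
  have "p = 0" if p: "p \<in> polys_in {}" "p \<in> P 0" for p
  proof -
    have "Poly_Mapping.keys p \<subseteq> {0}" using p(1) by (auto simp: polys_in_def)
    then have eq: "p = monom_of 0 (Poly_Mapping.lookup p 0)"
      by (intro poly_mapping_eqI) (auto simp: lookup_single when_def in_keys_iff)
    show ?thesis
    proof (rule ccontr)
      assume "p \<noteq> 0"
      then have c: "Poly_Mapping.lookup p 0 \<noteq> 0" using eq by (metis single_zero)
      have "monom_of 0 (1 / Poly_Mapping.lookup p 0) * p = 1"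
        by (subst (2) eq) (use c in \<open>simp add: mult_single\<close>)
      then show False
        using is_prime_ideal_one[OF 0(1)[of 0]] is_ideal_multL[OF _ p(2)] 0(1)[of 0]
        unfolding is_prime_ideal_def by (metis le_refl)
    qed
  qed
  then show ?case by (intro exI[of _ "{}"]) auto
next
  case (Suc k)
  obtain S where S: "card S = k" "polys_in S \<inter> P 1 \<subseteq> {0}"
    using Suc.IH[of "\<lambda>i. P (Suc i)"] Suc.prems by auto
  have "is_prime_ideal (P 0)" "is_ideal (P 1)" "P 0 \<subset> P 1"
    using Suc.prems(1)[of 0] Suc.prems(1)[of 1] Suc.prems(2)[of 0] by (auto simp: is_prime_ideal_def)
  from independent_coordinates_step[OF this S(2)] obtain j where
    "j \<notin> S" "polys_in (insert j S) \<inter> P 0 \<subseteq> {0}" by blast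
  then show ?case using S(1) by (intro exI[of _ "insert j S"]) auto
qed

text \<open>Chain lengths are cardinalities of sets of coordinates, hence bounded by
  \<open>CARD('d)\<close>, so the supremum is attained by some chain.\<close>

lemma real_dim_independent_coordinates:
  fixes V :: "(real ^ 'd::finite) set"
  assumes "real_dim V \<ge> 1"
  obtains P :: "('d, real) mpoly set" and S where "is_prime_ideal P" "Ireal V \<subseteq> P"
    "card S = real_dim V" "polys_in S \<inter> P \<subseteq> {0}"
proof -
  define T where "T = {k. \<exists>P :: nat \<Rightarrow> ('d, real) mpoly set.
      (\<forall>i\<le>k. is_prime_ideal (P i) \<and> Ireal V \<subseteq> P i) \<and> (\<forall>i<k. P i \<subset> P (Suc i))}"
  have dim: "real_dim V = Sup T" by (simp add: real_dim_def T_def)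
  have coord: "\<exists>P S. is_prime_ideal P \<and> Ireal V \<subseteq> P \<and> card S = k \<and> polys_in S \<inter> P \<subseteq> {0}"
    if k: "k \<in> T" for k
  proof -
    obtain P :: "nat \<Rightarrow> ('d, real) mpoly set" where
      P: "\<forall>i\<le>k. is_prime_ideal (P i) \<and> Ireal V \<subseteq> P i" "\<forall>i<k. P i \<subset> P (Suc i)"
      using k unfolding T_def by blast
    then obtain S where "card S = k" "polys_in S \<inter> P 0 \<subseteq> {0}"
      using prime_chain_independent_coordinates[of k P] by blast
    then show ?thesis using P by blast
  qed
  have "T \<subseteq> {..CARD('d)}"
    using coord card_mono[of "UNIV :: 'd set"] by fastforce
  then have fin: "finite T" by (rule finite_subset) simp
  \<comment> \<open>The supremum of the empty set of naturals is 0, which positive dimension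
    excludes.\<close>
  have "T \<noteq> {}" using assms dim by (auto simp: Sup_nat_def)
  then have "Sup T \<in> T" using fin by (simp add: Sup_nat_def)
  then show thesis using coord[of "Sup T"] that dim by metis
qed

section \<open>Partitioning polynomials\<close>

text \<open>Bounding each exponent by \<open>u\<close>, instead of the total degree, makes the
  number of monomials exactly \<open>(u + 1) ^ card S\<close>, at the cost of a factor
  \<open>card S\<close> in the degree.\<close>

lemma box_monomials:
  fixes S :: "'d::finite set"
  obtains e :: "nat \<Rightarrow> 'd \<Rightarrow>\<^sub>0 nat" where "inj_on e {..<(u + 1) ^ card S}"
    "\<And>j. j < (u + 1) ^ card S \<Longrightarrow> Poly_Mapping.keys (e j) \<subseteq> S"
    "\<And>j. j < (u + 1) ^ card S \<Longrightarrow> (\<Sum>i\<in>UNIV. Poly_Mapping.lookup (e j) i) \<le> card S * u"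
proof -
  define mono where "mono f = (\<Sum>i\<in>S. Poly_Mapping.single i (f i))" for f :: "'d \<Rightarrow> nat"
  define Y where "Y = PiE S (\<lambda>_. {..u})"
  have look: "Poly_Mapping.lookup (mono f) i = (if i \<in> S then f i else 0)" for f i
    by (simp add: mono_def lookup_sum lookup_single when_def)
  have inj: "inj_on mono Y"
  proof (rule inj_onI)
    fix f g assume fg: "f \<in> Y" "g \<in> Y" "mono f = mono g"
    have "f i = g i" if "i \<in> S" for i
      using fg(3) look[of f i] look[of g i] that by simp
    then show "f = g" using fg(1,2) unfolding Y_def by (intro PiE_ext) auto
  qed
  have "finite Y" "card Y = (u + 1) ^ card S" unfolding Y_def by (auto simp: finite_PiE card_PiE)
  then have "finite (mono ` Y)" "card (mono ` Y) = (u + 1) ^ card S" using inj by (auto simp: card_image)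
  then obtain e where e: "bij_betw e {0..<(u + 1) ^ card S} (mono ` Y)"
    using ex_bij_betw_nat_finite[of "mono ` Y"] by auto
  have e': "\<exists>f\<in>Y. e j = mono f" if "j < (u + 1) ^ card S" for j
    using bij_betwE[OF e] that by auto
  show thesis
  proof
    show "inj_on e {..<(u + 1) ^ card S}"
      using e by (simp add: bij_betw_def atLeast0LessThan)
    fix j assume "j < (u + 1) ^ card S"
    then obtain f where f: "f \<in> Y" "e j = mono f" using e' by blast
    show "Poly_Mapping.keys (e j) \<subseteq> S" unfolding f by (auto simp: in_keys_iff look split: if_splits)
    have "(\<Sum>i\<in>UNIV. Poly_Mapping.lookup (e j) i) = (\<Sum>i\<in>S. f i)"
      unfolding f by (simp add: look sum.If_cases)
    also have "\<dots> \<le> (\<Sum>i\<in>S. u)" using f(1) by (intro sum_mono) (auto simp: Y_def)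
    finally show "(\<Sum>i\<in>UNIV. Poly_Mapping.lookup (e j) i) \<le> card S * u" by simp
  qed
qed

text \<open>With \<open>u\<close> the integer part of the \<open>k\<close>-th root of
  \<open>m\<close>, the box has \<open>(u + 1) ^ k > m\<close> monomials, as
  \<open>splitting_combination_exists\<close> requires. A nontrivial combination of distinct
  monomials in \<open>S\<close> is a nonzero element of \<open>polys_in S\<close>, hence outside
  \<open>P\<close>.\<close>

lemma polynomial_splits_half:
  fixes P :: "('d::finite, real) mpoly set" and \<A> :: "(real ^ 'd) set set"
  assumes S: "card S \<ge> 1" "polys_in S \<inter> P \<subseteq> {0}"
    and \<A>: "finite \<A>" "\<And>A. A \<in> \<A> \<Longrightarrow> finite A" "{} \<notin> \<A>"
  shows "\<exists>h. h \<notin> P \<and> real (mpdeg h) \<le> card S * real (card \<A>) powr (1 / card S) \<and>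
           card \<A> \<le> 2 * card {A\<in>\<A>. splits (mpeval h) A}"
proof -
  define k where "k = card S"
  define m where "m = card \<A>"
  define u where "u = nat \<lfloor>real m powr (1 / k)\<rfloor>"
  define N where "N = (u + 1) ^ k"
  have k: "k \<ge> 1" using S by (simp add: k_def)
  have u_le: "real u \<le> real m powr (1 / k)" by (simp add: u_def)
  have "real m < real N"
  proof (cases "m = 0")
    case False
    have "real m powr (1 / k) < real (u + 1)" unfolding u_def by linarith
    then have "(real m powr (1 / k)) ^ k < real (u + 1) ^ k"
      using k by (intro power_strict_mono) auto
    moreover have "(real m powr (1 / k)) ^ k = real m"
      using k False by (simp add: powr_powr powr_realpow[symmetric])
    ultimately show ?thesis by (simp add: N_def)
  qed (simp add: N_def)
  then have mN: "card \<A> < N" by (simp add: m_def)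
  obtain e :: "nat \<Rightarrow> 'd \<Rightarrow>\<^sub>0 nat" where e: "inj_on e {..<N}"
    "\<And>j. j < N \<Longrightarrow> Poly_Mapping.keys (e j) \<subseteq> S"
    "\<And>j. j < N \<Longrightarrow> (\<Sum>i\<in>UNIV. Poly_Mapping.lookup (e j) i) \<le> k * u"
    using box_monomials[of u S] unfolding N_def k_def by blast
  obtain a where a: "\<exists>j<N. a j \<noteq> 0"
    "card \<A> \<le> 2 * card {A\<in>\<A>. splits (\<lambda>y. \<Sum>j<N. a j * mpmon (e j) y) A}"
    using splitting_combination_exists[OF \<A>(1) mN, of "\<lambda>A. A" "\<lambda>j. mpmon (e j)"] \<A> by blast
  define h where "h = (\<Sum>j<N. monom_of (e j) (a j))"
  have look: "Poly_Mapping.lookup h (e j) = a j" if "j < N" for j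
  proof -
    have "Poly_Mapping.lookup h (e j) = (\<Sum>i<N. if i = j then a j else 0)"
      unfolding h_def lookup_sum
      by (intro sum.cong refl) (use that e(1) in \<open>auto simp: lookup_single when_def inj_on_def\<close>)
    then show ?thesis using that by simp
  qed
  have "h \<noteq> 0" using a(1) look by (metis lookup_zero)
  moreover have "h \<in> polys_in S" unfolding h_def by (intro polys_in_sum polys_in_single e) auto
  ultimately have "h \<notin> P" using S(2) by blast
  moreover have "mpdeg h \<le> k * u"
    unfolding mpdeg_le_iff
  proof
    fix m assume "m \<in> Poly_Mapping.keys h"
    then have "(\<Sum>j<N. Poly_Mapping.lookup (monom_of (e j) (a j)) m) \<noteq> 0"
      by (simp add: h_def in_keys_iff lookup_sum)
    then obtain j where "j < N" "Poly_Mapping.lookup (monom_of (e j) (a j)) m \<noteq> 0"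
      by (meson lessThan_iff sum.neutral)
    then show "(\<Sum>i\<in>UNIV. Poly_Mapping.lookup m i) \<le> k * u"
      using e(3) by (auto simp: lookup_single when_def split: if_splits)
  qed
  then have "real (mpdeg h) \<le> real (k * u)" by (simp only: of_nat_le_iff)
  then have "real (mpdeg h) \<le> k * real m powr (1 / k)"
    using u_le by (smt (verit) mult_left_mono of_nat_0_le_iff of_nat_mult)
  moreover have "mpeval h = (\<lambda>y. \<Sum>j<N. a j * mpmon (e j) y)"
    by (rule ext) (simp add: h_def mpeval_sum mpeval_single)
  ultimately show ?thesis using a(2) unfolding k_def m_def by auto
qed

section \<open>Cutting connected sets off the zero set\<close>

definition cuts :: "('d::finite, real) mpoly \<Rightarrow> (real ^ 'd) set \<Rightarrow> bool" where
  "cuts h A \<longleftrightarrow> (\<forall>C. connected C \<and> C \<inter> Zr h = {} \<longrightarrow> 10 * card (A \<inter> C) \<le> 9 * card A)"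

text \<open>By the intermediate value theorem \<open>mpeval h\<close> keeps one strict sign on a
  connected set that avoids \<open>Zr h\<close>.\<close>

lemma splits_imp_cuts:
  assumes A: "finite A" and s: "splits (mpeval h) A"
  shows "cuts h A"
  unfolding cuts_def
proof (intro allI impI, elim conjE)
  fix C assume C: "connected C" "C \<inter> Zr h = {}"
  have conn: "connected (mpeval h ` C)"
    by (rule connected_continuous_image[OF continuous_on_mpeval C(1)])
  have "0 \<notin> mpeval h ` C" using C(2) by (auto simp: Zr_def)
  then have "(\<forall>y\<in>C. mpeval h y > 0) \<or> (\<forall>y\<in>C. mpeval h y < 0)"
    using connectedD_interval[OF conn, of _ _ 0] by (metis image_eqI linorder_neqE_linordered_idom order_less_imp_le)
  then have "A \<inter> C \<subseteq> {y\<in>A. mpeval h y > 0} \<or> A \<inter> C \<subseteq> {y\<in>A. mpeval h y < 0}" by blast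
  then have "card (A \<inter> C) \<le> card {y\<in>A. mpeval h y > 0} \<or> card (A \<inter> C) \<le> card {y\<in>A. mpeval h y < 0}"
    using A card_mono[of "{y\<in>A. mpeval h y > 0}" "A \<inter> C"] card_mono[of "{y\<in>A. mpeval h y < 0}" "A \<inter> C"]
    by fastforce
  then show "10 * card (A \<inter> C) \<le> 9 * card A" using s unfolding splits_def by linarith
qed

lemma cuts_mult: "cuts p A \<or> cuts q A \<Longrightarrow> cuts (p * q) A"
  unfolding cuts_def Zr_mult by blast

text \<open>Each round leaves at most half of the sets unsplit, so with \<open>k = card S\<close>
  the degree bounds shrink by the factor \<open>q = (1 / 2) powr (1 / k)\<close>. The geometric
  series contributes \<open>1 / (1 - q)\<close>, and the product of the rounds stays outside the
  prime \<open>P\<close>.\<close>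

lemma polynomial_cuts_all:
  fixes P :: "('d::finite, real) mpoly set" and \<A> :: "(real ^ 'd) set set"
  assumes P: "is_prime_ideal P" and S: "card S \<ge> 1" "polys_in S \<inter> P \<subseteq> {0}"
    and \<A>: "finite \<A>" "\<And>A. A \<in> \<A> \<Longrightarrow> finite A" "{} \<notin> \<A>"
  shows "\<exists>h. h \<notin> P \<and> (\<forall>A\<in>\<A>. cuts h A) \<and>
     real (mpdeg h) \<le> card S / (1 - (1 / 2) powr (1 / card S)) * real (card \<A>) powr (1 / card S)"
  using \<A>
proof (induction "card \<A>" arbitrary: \<A> rule: less_induct)
  case less
  define k where "k = card S"
  define q where "q = (1 / 2 :: real) powr (1 / k)"
  have k: "k \<ge> 1" using S by (simp add: k_def)
  have q: "0 < q" "q < 1" using k powr_less_mono2[of "1 / k" "1/2" 1] by (auto simp: q_def)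
  show ?case
  proof (cases "\<A> = {}")
    case True
    then show ?thesis
      by (intro exI[of _ 1]) (use is_prime_ideal_one[OF P] in \<open>auto simp: mpdeg_one\<close>)
  next
    case False
    then have pos: "card \<A> > 0" using less.prems by auto
    obtain h where h: "h \<notin> P" "real (mpdeg h) \<le> k * real (card \<A>) powr (1 / k)"
      "card \<A> \<le> 2 * card {A\<in>\<A>. splits (mpeval h) A}"
      using polynomial_splits_half[OF S less.prems] unfolding k_def by blast
    define \<B> where "\<B> = {A\<in>\<A>. \<not> splits (mpeval h) A}"
    have "card \<A> = card {A\<in>\<A>. splits (mpeval h) A} + card \<B>"
      unfolding \<B>_def using less.prems(1)
      by (subst card_Un_disjoint[symmetric]) (auto intro!: arg_cong[where f=card])
    then have \<B>: "2 * card \<B> \<le> card \<A>" using h(3) by linarith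
    obtain g where g: "g \<notin> P" "\<forall>A\<in>\<B>. cuts g A"
      "real (mpdeg g) \<le> k / (1 - q) * real (card \<B>) powr (1 / k)"
      using less.hyps[of \<B>] less.prems \<B> pos unfolding q_def k_def by (auto simp: \<B>_def)
    have "real (card \<B>) powr (1 / k) \<le> (1 / 2 * card \<A>) powr (1 / k)"
      using \<B> by (intro powr_mono2) auto
    also have "\<dots> = q * real (card \<A>) powr (1 / k)" unfolding q_def by (rule powr_mult) 
    finally have "k / (1 - q) * real (card \<B>) powr (1 / k) \<le> k / (1 - q) * (q * real (card \<A>) powr (1 / k))"
      using q by (intro mult_left_mono) auto
    then have "real (mpdeg h) + real (mpdeg g)
        \<le> k * real (card \<A>) powr (1 / k) + k / (1 - q) * (q * real (card \<A>) powr (1 / k))"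
      using h g by linarith
    also have "\<dots> = k / (1 - q) * real (card \<A>) powr (1 / k)"
      using q by (simp add: field_simps)
    finally have deg: "real (mpdeg (h * g)) \<le> k / (1 - q) * real (card \<A>) powr (1 / k)"
      using mpdeg_mult_le[of h g] by linarith
    have "cuts (h * g) A" if "A \<in> \<A>" for A
    proof (cases "A \<in> \<B>")
      case True
      then show ?thesis using g(2) by (simp add: cuts_mult)
    next
      case False
      then have "splits (mpeval h) A" using that by (simp add: \<B>_def)
      then show ?thesis using splits_imp_cuts less.prems(2)[OF that] cuts_mult by blast
    qed
    then show ?thesis
      using deg is_prime_ideal_mult[OF P h(1) g(1)] unfolding q_def k_def by blast
  qed
qed

lemma power_powr_commute: "0 < a \<Longrightarrow> (a ^ n) powr y = (a powr y) ^ n" for a :: real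
  by (simp add: powr_powr powr_realpow[symmetric] mult.commute)

text \<open>Distinct traces come from distinct components and are disjoint. This limits how many
  cells can contain many points.\<close>

lemma components_card_sum_le:
  assumes X: "finite X" and \<A>: "\<A> \<subseteq> (\<lambda>K. X \<inter> K) ` components U"
  shows "(\<Sum>A\<in>\<A>. card A) \<le> card X"
proof -
  have sub: "A \<subseteq> X" if "A \<in> \<A>" for A using that \<A> by auto
  have "disjnt A B" if AB: "A \<in> \<A>" "B \<in> \<A>" "A \<noteq> B" for A B
  proof -
    obtain K where K: "A = X \<inter> K" "K \<in> components U" using AB(1) \<A> by auto
    obtain L where L: "B = X \<inter> L" "L \<in> components U" using AB(2) \<A> by auto
    have "K \<noteq> L" using K L AB(3) by auto
    then have "K \<inter> L = {}" using components_nonoverlap[OF K(2) L(2)] by simp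
    then show ?thesis using K(1) L(1) by (auto simp: disjnt_def)
  qed
  then have "pairwise disjnt \<A>" by (simp add: pairwise_def)
  then have "(\<Sum>A\<in>\<A>. card A) = card (\<Union>\<A>)"
    using sub X finite_subset by (intro card_Union_disjoint[symmetric]) blast+
  also have "\<dots> \<le> card X" using sub X by (intro card_mono) auto
  finally show ?thesis .
qed

text \<open>Only the fewer than \<open>(10/9)^(t+1)\<close> cells that are still too large have to be cut in
  step \<open>t + 1\<close>, so the degrees of the factors form a geometric series.\<close>

lemma partition_power:
  fixes P :: "('d::finite, real) mpoly set" and X :: "(real ^ 'd) set"
  assumes P: "is_prime_ideal P" and S: "card S \<ge> 1" "polys_in S \<inter> P \<subseteq> {0}" and X: "finite X"
  defines "w \<equiv> (10 / 9 :: real) powr (1 / card S)"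
  defines "c \<equiv> card S / (1 - (1 / 2) powr (1 / card S)) * w / (w - 1)"
  shows "\<exists>g. g \<notin> P \<and> real (mpdeg g) \<le> c * w ^ t \<and>
     (\<forall>C. connected C \<and> C \<inter> Zr g = {} \<longrightarrow> card (X \<inter> C) * (10 / 9) ^ t \<le> real (card X))"
proof (induction t)
  case 0
  have w: "w > 1" unfolding w_def using S by simp
  have "(1 / 2 :: real) powr (1 / card S) < 1" using S powr_less_mono2[of "1 / card S" "1/2" 1] by auto
  then have "c \<ge> 0" using w by (simp add: c_def)
  then show ?case
    by (intro exI[of _ 1]) (use is_prime_ideal_one[OF P] X in \<open>auto simp: mpdeg_one intro!: card_mono\<close>)
next
  case (Suc t)
  define b where "b = card S / (1 - (1 / 2) powr (1 / card S))"
  have w: "w > 1" unfolding w_def using S by simp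
  have "(1 / 2 :: real) powr (1 / card S) < 1" using S powr_less_mono2[of "1 / card S" "1/2" 1] by auto
  then have b: "b \<ge> 0" by (simp add: b_def)
  obtain g where g: "g \<notin> P" "real (mpdeg g) \<le> c * w ^ t"
    "\<And>C. connected C \<Longrightarrow> C \<inter> Zr g = {} \<Longrightarrow> card (X \<inter> C) * (10 / 9) ^ t \<le> real (card X)"
    using Suc by blast
  define \<rho> where "\<rho> = (10 / 9 :: real) ^ Suc t"
  have \<rho>: "\<rho> > 0" by (simp add: \<rho>_def)
  \<comment> \<open>Only cells with more than \<open>card X / \<rho>\<close> points need cutting;
    the others already meet the bound for \<open>Suc t\<close>.\<close>
  define \<A> where "\<A> = {A \<in> (\<lambda>K. X \<inter> K) ` components (- Zr g). card A * \<rho> > card X}"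
  have "\<A> \<subseteq> Pow X" by (auto simp: \<A>_def)
  then have \<A>: "finite \<A>" "\<And>A. A \<in> \<A> \<Longrightarrow> finite A" "{} \<notin> \<A>"
    using X finite_subset[of \<A> "Pow X"] finite_subset[of _ X] by (auto simp: \<A>_def)
  obtain h where h: "h \<notin> P" "\<forall>A\<in>\<A>. cuts h A" "real (mpdeg h) \<le> b * real (card \<A>) powr (1 / card S)"
    using polynomial_cuts_all[OF P S \<A>] unfolding b_def by blast
  have card_\<A>: "card \<A> \<le> \<rho>"
  proof (cases "\<A> = {}")
    case False
    have "card \<A> * real (card X) = (\<Sum>A\<in>\<A>. real (card X))" by simp
    also have "\<dots> \<le> (\<Sum>A\<in>\<A>. card A * \<rho>)" by (intro sum_mono) (auto simp: \<A>_def)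
    also have "\<dots> = real (\<Sum>A\<in>\<A>. card A) * \<rho>" by (simp add: sum_distrib_right)
    also have "\<dots> \<le> real (card X) * \<rho>"
      using components_card_sum_le[OF X, of \<A> "- Zr g"] \<rho> unfolding \<A>_def
      by (intro mult_right_mono of_nat_mono) auto
    finally have "card \<A> * real (card X) \<le> \<rho> * real (card X)" by (simp add: mult.commute)
    moreover have "card X > 0" using False X by (auto simp: \<A>_def card_gt_0_iff)
    ultimately show ?thesis by simp
  qed (use \<rho> in simp)
  have "real (card \<A>) powr (1 / card S) \<le> \<rho> powr (1 / card S)"
    using card_\<A> by (intro powr_mono2) auto
  also have "\<dots> = w ^ Suc t"
    unfolding \<rho>_def w_def by (rule power_powr_commute) simp
  finally have "b * real (card \<A>) powr (1 / card S) \<le> b * w ^ Suc t" using b by (rule mult_left_mono)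
  then have "real (mpdeg g) + real (mpdeg h) \<le> c * w ^ t + b * w ^ Suc t" using g h by linarith
  \<comment> \<open>The constant \<open>c\<close> is the solution of
    \<open>c + b * w = c * w\<close>, which makes the degree bound reproduce itself.\<close>
  also have "\<dots> = c * w ^ Suc t"
    using w by (simp add: c_def b_def[symmetric] field_simps)
  finally have deg: "real (mpdeg (g * h)) \<le> c * w ^ Suc t"
    using mpdeg_mult_le[of g h] by linarith
  have "card (X \<inter> C) * \<rho> \<le> card X" if C: "connected C" "C \<inter> Zr (g * h) = {}" for C
  proof (cases "C = {}")
    case False
    have C': "C \<subseteq> - Zr g" "C \<inter> Zr h = {}" using C(2) by (auto simp: Zr_mult)
    obtain K where K: "K \<in> components (- Zr g)" "C \<subseteq> K"
    proof -
      have "- Zr g \<noteq> {}" using C'(1) False by auto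
      from exists_component_superset[OF C'(1) this C(1)] show ?thesis using that by blast
    qed
    have KC: "card (X \<inter> C) \<le> card (X \<inter> K)" using X K by (intro card_mono) auto
    show ?thesis
    proof (cases "X \<inter> K \<in> \<A>")
      case True
      then have "10 * card ((X \<inter> K) \<inter> C) \<le> 9 * card (X \<inter> K)"
        using h(2) C(1) C'(2) by (auto simp: cuts_def)
      moreover have "(X \<inter> K) \<inter> C = X \<inter> C" using K by blast
      ultimately have "10 * real (card (X \<inter> C)) \<le> 9 * real (card (X \<inter> K))" by simp
      \<comment> \<open>The factor 9/10 gained from \<open>h\<close> offsets the additional factor
        10/9 in \<open>\<rho>\<close>.\<close>
      then have "card (X \<inter> C) * \<rho> \<le> card (X \<inter> K) * (10 / 9) ^ t"
        unfolding \<rho>_def by simp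
      also have "\<dots> \<le> card X"
        using K in_components_connected in_components_subset by (intro g(3)) blast+
      finally show ?thesis .
    next
      case False
      then have "card (X \<inter> K) * \<rho> \<le> card X" using K by (auto simp: \<A>_def)
      moreover have "card (X \<inter> C) * \<rho> \<le> card (X \<inter> K) * \<rho>" using KC \<rho> by simp
      ultimately show ?thesis by linarith
    qed
  qed simp
  then show ?case
    using deg is_prime_ideal_mult[OF P g(1) h(1)] unfolding \<rho>_def by blast
qed

text \<open>The quantifier order makes \<open>C\<close> uniform in the prime, the coordinates, the
  points and \<open>r\<close>. It remains to round \<open>r\<close> up to a power of 10/9 in
  \<open>partition_power\<close>.\<close>

lemma partitioning_poly_modulo_prime:
  fixes k :: nat
  assumes k: "k \<ge> 1"
  shows "\<exists>C\<ge>0. \<forall>(P :: ('d::finite, real) mpoly set) S X r. is_prime_ideal P \<longrightarrow> card S = k \<longrightarrow>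
    polys_in S \<inter> P \<subseteq> {0} \<longrightarrow> finite X \<longrightarrow> 1 < r \<longrightarrow>
    (\<exists>g. partitioning_poly r X g \<and> g \<notin> P \<and> real (mpdeg g) \<le> C * r powr (1 / k))"
proof -
  define w where "w = (10 / 9 :: real) powr (1 / k)"
  define c where "c = k / (1 - (1 / 2) powr (1 / k)) * w / (w - 1)"
  have w: "w > 1" unfolding w_def using k by simp
  have "(1 / 2 :: real) powr (1 / k) < 1" using k powr_less_mono2[of "1 / k" "1/2" 1] by auto
  then have c: "c \<ge> 0" using w by (simp add: c_def)
  show ?thesis
  proof (intro exI[of _ "c * w"] conjI allI impI)
    show "c * w \<ge> 0" using c w by simp
    fix P :: "('d, real) mpoly set" and S and X :: "(real ^ 'd) set" and r
    assume P: "is_prime_ideal P" and S: "card S = k" "polys_in S \<inter> P \<subseteq> {0}" and X: "finite X"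
      and r: "1 < (r :: real)"
    have "\<exists>t. r \<le> (10 / 9) ^ t"
      using real_arch_pow[of "10 / 9" r] by (auto intro: less_imp_le)
    \<comment> \<open>The least exponent is positive since \<open>r > 1\<close>, and its power
      exceeds \<open>r\<close> by a factor of at most 10/9, which costs one factor \<open>w\<close>
      in the degree.\<close>
    define t where "t = (LEAST t. r \<le> (10 / 9) ^ t)"
    have t: "r \<le> (10 / 9) ^ t" unfolding t_def by (rule LeastI_ex) fact
    have "t \<noteq> 0" using t r by (cases "t = 0") auto
    then obtain s where s: "t = Suc s" by (cases t) auto
    have "\<not> r \<le> (10 / 9) ^ s" using not_less_Least[of s "\<lambda>t. r \<le> (10 / 9) ^ t"] s by (simp add: t_def)
    then have "(10 / 9) ^ t \<le> 10 / 9 * r" by (simp add: s)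
    then have "((10 / 9) ^ t) powr (1 / k) \<le> (10 / 9 * r) powr (1 / k)"
      by (intro powr_mono2) auto
    moreover have "((10 / 9) ^ t) powr (1 / k) = w ^ t"
      unfolding w_def by (rule power_powr_commute) simp
    moreover have "(10 / 9 * r) powr (1 / k) = w * r powr (1 / k)"
      unfolding w_def by (rule powr_mult)
    ultimately have "w ^ t \<le> w * r powr (1 / k)" by simp
    then have wt: "c * w ^ t \<le> c * w * r powr (1 / k)"
      using mult_left_mono[OF _ c] by (simp add: mult.assoc)
    obtain g where g: "g \<notin> P" "real (mpdeg g) \<le> c * w ^ t"
      "\<And>C. connected C \<Longrightarrow> C \<inter> Zr g = {} \<Longrightarrow> card (X \<inter> C) * (10 / 9) ^ t \<le> real (card X)"
      using partition_power[OF P _ S(2) X, of t] k unfolding c_def w_def S(1) by blast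
    have "partitioning_poly r X g"
      unfolding partitioning_poly_def
    proof
      fix x assume "x \<in> - Zr g"
      let ?C = "connected_component_set (- Zr g) x"
      have "card (X \<inter> ?C) * r \<le> card (X \<inter> ?C) * (10 / 9) ^ t" using t by (intro mult_left_mono) auto
      also have "\<dots> \<le> card X"
        using connected_component_subset[of "- Zr g" x] by (intro g(3)) auto
      finally show "real (card (X \<inter> ?C)) \<le> real (card X) / r" using r by (simp add: field_simps)
    qed
    then show "\<exists>g. partitioning_poly r X g \<and> g \<notin> P \<and> real (mpdeg g) \<le> c * w * r powr (1 / k)"
      using g wt by (intro exI[of _ g]) auto
  qed
qed

theorem theorem4p2:
  fixes D :: nat
  shows "\<exists>C :: real. \<forall>(P :: (real ^ 'd::finite) set) V r.
    finite P \<and> real_irreducible V \<and> real_var_degree V = D \<and> real_dim V \<ge> 1 \<and>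
    1 < r \<and> r \<le> real (card P) \<longrightarrow>
    (\<exists>g. partitioning_poly r P g \<and> g \<notin> Ireal V \<and>
         real (mpdeg g) \<le> C * r powr (1 / real (real_dim V)))"
proof -
  define good where "good k C \<longleftrightarrow> (\<forall>(Q :: ('d, real) mpoly set) S X r. is_prime_ideal Q \<longrightarrow> card S = k \<longrightarrow>
    polys_in S \<inter> Q \<subseteq> {0} \<longrightarrow> finite X \<longrightarrow> 1 < r \<longrightarrow>
    (\<exists>g. partitioning_poly r X g \<and> g \<notin> Q \<and> real (mpdeg g) \<le> C * r powr (1 / k)))" for k C
  have "\<exists>C\<ge>0. good k C" if "k \<ge> 1" for k
    unfolding good_def by (rule partitioning_poly_modulo_prime[OF that])
  then obtain c where c: "\<And>k. k \<ge> 1 \<Longrightarrow> c k \<ge> 0 \<and> good k (c k)"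
    by metis
  show ?thesis
  \<comment> \<open>The dimension lies between 1 and \<open>CARD('d)\<close> and all summands are
    nonnegative, so the sum dominates the constant of every dimension that can occur.\<close>
  proof (intro exI[of _ "\<Sum>k=1..CARD('d). c k"] allI impI, elim conjE)
    fix P V :: "(real ^ 'd) set" and r :: real
    assume P: "finite P" and V: "1 \<le> real_dim V" and r: "1 < r"
    obtain Q :: "('d, real) mpoly set" and S where Q: "is_prime_ideal Q" "Ireal V \<subseteq> Q"
      "card S = real_dim V" "polys_in S \<inter> Q \<subseteq> {0}"
      using real_dim_independent_coordinates[OF V] .
    have "good (real_dim V) (c (real_dim V))" using c[OF V] by simp
    from this[unfolded good_def, rule_format, OF Q(1,3,4) P r] obtain g where g: "partitioning_poly r P g" "g \<notin> Q"
      "real (mpdeg g) \<le> c (real_dim V) * r powr (1 / real (real_dim V))" by blast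
    have "real_dim V \<le> CARD('d)" using Q(3) card_mono[of "UNIV :: 'd set" S] by simp
    then have "c (real_dim V) \<le> (\<Sum>k=1..CARD('d). c k)"
      using V c by (intro member_le_sum) auto
    then have "c (real_dim V) * r powr (1 / real (real_dim V)) \<le> (\<Sum>k=1..CARD('d). c k) * r powr (1 / real (real_dim V))"
      by (intro mult_right_mono) auto
    then show "\<exists>g. partitioning_poly r P g \<and> g \<notin> Ireal V \<and>
         real (mpdeg g) \<le> (\<Sum>k=1..CARD('d). c k) * r powr (1 / real (real_dim V))"
      using g Q(2) by (intro exI[of _ g]) auto
  qed
qed

end
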